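(* Let $A$ be a zonoid in $\mathbb{R}^3$ and let $u,v\in S^2$. Then $$|A|_3\,|P_{[u,v]^\perp}A|_1\sqrt{1-\langle u,v\rangle^2}\le|P_{u^\perp}A|_2\,|P_{v^\perp}A|_2.$$
   Context: A zonotope is a finite Minkowski sum of segments; a zonoid is a limit of zonotopes in the Hausdorff metric. $|\cdot|_m$ is $m$-dimensional volume. $P_E$ is the orthogonal projection onto a subspace $E$; $u^\perp$ is the plane orthogonal to $u$; $[u,v]^\perp$ is the orthogonal complement of the span of $u$ and $v$; the left-hand side is $0$ when $u=\pm v$. *)

theory Defs
  imports "HOL-Analysis.Analysis"
begin

definition zonotope :: "'a::euclidean_space set \<Rightarrow> bool" where
  "zonotope Z \<longleftrightarrow>
     (\<exists>(n::nat) (a::nat \<Rightarrow> 'a) (b::nat \<Rightarrow> 'a). Z = (\<Sum>i<n. closed_segment (a i) (b i)))"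

(* The Hausdorff metric on nonempty compact sets; on other sets the suprema may be junk. *)
definition hausdorff_dist :: "'a::metric_space set \<Rightarrow> 'a set \<Rightarrow> real" where
  "hausdorff_dist A B = max (SUP a\<in>A. infdist a B) (SUP b\<in>B. infdist b A)"

definition zonoid :: "'a::euclidean_space set \<Rightarrow> bool" where
  "zonoid A \<longleftrightarrow> compact A \<and> A \<noteq> {} \<and>
     (\<exists>Z. (\<forall>n::nat. zonotope (Z n)) \<and> (\<lambda>n. hausdorff_dist (Z n) A) \<longlonglongrightarrow> 0)"

definition orth_proj :: "'a::euclidean_space set \<Rightarrow> 'a \<Rightarrow> 'a" where
  "orth_proj E x = (THE y. y \<in> E \<and> x - y \<in> orthogonal_comp E)"

definition isometric_param :: "(real^'m \<Rightarrow> 'a::euclidean_space) \<Rightarrow> 'a set \<Rightarrow> bool" where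
  "isometric_param f E \<longleftrightarrow> linear f \<and> (\<forall>x. norm (f x) = norm x) \<and> range f = E"

(* Lebesgue measure of dimension CARD('m) on a linear subspace E of that dimension,
   transported along an isometry of real^'m onto E. For measurable sets the value does not
   depend on the isometry chosen (subspace_volume_eq). If E has another dimension the value is unspecified. *)
definition subspace_volume :: "'m::finite itself \<Rightarrow> 'a::euclidean_space set \<Rightarrow> 'a set \<Rightarrow> real" where
  "subspace_volume _ E S =
     measure lebesgue ((SOME f :: real^'m \<Rightarrow> 'a. isometric_param f E) -` S)"

lemma isometric_param_exists:
  fixes E :: "'a::euclidean_space set"
  assumes "subspace E" "dim E = CARD('m::finite)"
  shows "\<exists>f :: real^'m \<Rightarrow> 'a. isometric_param f E"
proof -
  have "dim (UNIV :: (real^'m) set) = dim E" using assms by simp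
  then obtain f :: "real^'m \<Rightarrow> 'a" and g where "linear f" "f ` UNIV = E"
      "\<And>x. x \<in> UNIV \<Longrightarrow> norm (f x) = norm x"
    using isometries_subspaces[OF subspace_UNIV assms(1)] by metis
  then show ?thesis unfolding isometric_param_def by auto
qed

lemma subspace_volume_eq:
  fixes f :: "real^'m::{finite,wellorder} \<Rightarrow> 'a::euclidean_space"
  assumes f: "isometric_param f E" and S: "S \<subseteq> E"
    and meas: "f -` S \<in> lmeasurable"
  shows "subspace_volume TYPE('m) E S = measure lebesgue (f -` S)"
proof -
  define g where "g = (SOME g :: real^'m::_ \<Rightarrow> 'a. isometric_param g E)"
  have g: "isometric_param g E" unfolding g_def using someI[of "\<lambda>g. isometric_param g E", OF f] .
  have inj: "inj h" if "isometric_param h E" for h :: "real^'m::_ \<Rightarrow> 'a"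
    using that unfolding isometric_param_def
    by (metis linear_injective_0 norm_eq_zero)
  define T where "T = inv g \<circ> f"
  have gT: "g (T x) = f x" for x
    unfolding T_def using f g by (auto simp: isometric_param_def intro!: f_inv_into_f)
  have "linear T"
  proof (rule linearI)
    fix x y c
    have "g (T (x + y)) = g (T x + T y)" "g (T (c *\<^sub>R x)) = g (c *\<^sub>R T x)"
      using f g by (simp_all add: gT isometric_param_def linear_add linear_scale)
    then show "T (x + y) = T x + T y" "T (c *\<^sub>R x) = c *\<^sub>R T x"
      using inj[OF g] by (simp_all add: inj_eq)
  qed
  moreover have "norm (T x) = norm x" for x
    using f g gT unfolding isometric_param_def by metis
  ultimately have T: "orthogonal_transformation T"
    by (simp add: orthogonal_transformation)
  have "g -` S = T ` (f -` S)"
  proof (intro equalityI subsetI)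
    fix y assume "y \<in> g -` S"
    moreover obtain x where "y = T x"
      using orthogonal_transformation_surj[OF T] by (metis surjD)
    ultimately show "y \<in> T ` (f -` S)" by (auto simp: gT)
  qed (auto simp: gT)
  then show ?thesis
    unfolding subspace_volume_def g_def[symmetric]
    using measure_orthogonal_image[OF T meas] by simp
qed

lemma orth_proj:
  fixes E :: "'a::euclidean_space set"
  assumes "subspace E"
  shows "orth_proj E x \<in> E \<and> x - orth_proj E x \<in> orthogonal_comp E"
  unfolding orth_proj_def
proof (rule theI')
  have "\<exists>y z. y \<in> span E \<and> (\<forall>w\<in>span E. orthogonal z w) \<and> x = y + z"
    using orthogonal_subspace_decomp_exists[of E x] by metis
  then obtain y z where yz: "y \<in> E" "\<forall>w\<in>E. orthogonal z w" "x = y + z"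
    using assms by (auto simp: span_eq_iff[THEN iffD2])
  show "\<exists>!y. y \<in> E \<and> x - y \<in> orthogonal_comp E"
  proof (rule ex1I[of _ y])
    show "y \<in> E \<and> x - y \<in> orthogonal_comp E"
      using yz by (auto simp: orthogonal_comp_def orthogonal_commute)
  next
    fix y' assume y': "y' \<in> E \<and> x - y' \<in> orthogonal_comp E"
    have "y' - y \<in> E" using y' yz(1) assms by (simp add: subspace_diff)
    then have "orthogonal (y' - y) z" "orthogonal (y' - y) (x - y')"
      using y' yz(2) by (auto simp: orthogonal_comp_def orthogonal_commute)
    then have "(y' - y) \<bullet> (y' - y) = 0"
      unfolding orthogonal_def yz(3) by (simp add: inner_diff_right inner_add_right)
    then show "y' = y" by simp
  qed
qed

end

theory Submission
  imports Defs
begin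

text \<open>Up to translation and a small perturbation a zonotope is a sum of segments \<open>[0, z\<^sub>i (x\<^sub>i, y\<^sub>i, 1)]\<close>, in coordinates
  where \<open>u\<close> and \<open>v\<close> span the horizontal plane. The volumes of the zonotope and of its projections
  are sums of absolute values of determinants of the generators, so for weights \<open>z\<^sub>i\<close> the theorem
  becomes \<open>2 E\<bar>det (P\<^sub>1, P\<^sub>2, P\<^sub>3)\<bar> \<le> 3 E\<bar>X\<^sub>1 - X\<^sub>2\<bar> E\<bar>Y\<^sub>1 - Y\<^sub>2\<bar>\<close> for independent
  copies \<open>P\<^sub>i = (X\<^sub>i, Y\<^sub>i)\<close> of a random point of the plane. The left-hand side is subadditive and the
  right-hand side additive under the layer-cake decomposition of \<open>X\<close> and of \<open>Y\<close>, which reduces the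
  claim to points in \<open>{0, 1}\<^sup>2\<close>, where it is a perfect square. Zonoids follow because volume is
  continuous on convex bodies in the Hausdorff metric.\<close>

subsection \<open>Lebesgue measure of compact sets\<close>

text \<open>Both orders of slicing are needed: vertical fibres when a segment is added, slices at
  fixed height for shears.\<close>

lemma emeasure_lborel_compact_fubini:
  fixes K :: "('a::euclidean_space \<times> 'b::euclidean_space) set"
  assumes "compact K"
  shows "emeasure lborel K = (\<integral>\<^sup>+ x. emeasure lborel (Pair x -` K) \<partial>lborel)"
    and "emeasure lborel K = (\<integral>\<^sup>+ y. emeasure lborel ((\<lambda>x. (x, y)) -` K) \<partial>lborel)"
proof -
  have K: "K \<in> sets (lborel \<Otimes>\<^sub>M lborel)"
    using assms unfolding lborel_prod by (simp add: borel_compact)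
  show "emeasure lborel K = (\<integral>\<^sup>+ x. emeasure lborel (Pair x -` K) \<partial>lborel)"
    by (subst lborel_prod[symmetric], rule lborel.emeasure_pair_measure_alt[OF K])
  show "emeasure lborel K = (\<integral>\<^sup>+ y. emeasure lborel ((\<lambda>x. (x, y)) -` K) \<partial>lborel)"
    by (subst lborel_prod[symmetric], rule lborel_pair.emeasure_pair_measure_alt2[OF K])
qed

lemma emeasure_lborel_compact_eq_measure:
  fixes K :: "'a::euclidean_space set"
  shows "compact K \<Longrightarrow> emeasure lborel K = ennreal (measure lborel K)"
  using emeasure_compact_finite[of K] by (intro emeasure_eq_ennreal_measure) auto

lemma emeasure_lborel_compact_translation:
  fixes A :: "'a::euclidean_space set"
  assumes "compact A"
  shows "emeasure lborel ((\<lambda>x. x + p) ` A) = emeasure lborel A"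
proof -
  have "(\<lambda>x. x + p) ` A = (+) (- p) -` A"
    by (auto simp: image_iff algebra_simps intro!: bexI[of _ "_ - p"])
  then have "emeasure lborel ((\<lambda>x. x + p) ` A) = emeasure (distr lborel borel ((+) (- p))) A"
    using assms by (simp add: emeasure_distr borel_compact)
  then show ?thesis by (simp add: lborel_distr_plus)
qed

lemma compact_set_plus:
  fixes A B :: "'a::real_normed_vector set"
  assumes "compact A" "compact B"
  shows "compact (A + B)"
proof -
  have "A + B = (\<Union>x\<in>A. \<Union>y\<in>B. {x + y})" by (auto simp: set_plus_def)
  then show ?thesis using compact_sums'[OF assms] by simp
qed

lemma compact_linear_image:
  fixes f :: "'a::euclidean_space \<Rightarrow> 'b::real_normed_vector"
  assumes "linear f" "compact S"
  shows "compact (f ` S)"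
proof (rule compact_continuous_image[OF _ assms(2)])
  show "continuous_on S f"
    by (rule linear_continuous_on) (use assms(1) in \<open>simp add: linear_conv_bounded_linear\<close>)
qed

text \<open>Convexity makes every nonempty fibre of \<open>K\<close> a compact interval, and the sum
  lengthens each by exactly \<open>t\<close>. The nonempty fibres sit over the image of
  \<open>K\<close> under \<open>fst\<close>, so Fubini gives the extra term.\<close>

lemma measure_add_vertical_segment:
  fixes K :: "('a::euclidean_space \<times> real) set"
  assumes K: "compact K" "convex K" and t: "0 \<le> t"
  shows "measure lborel (K + {0} \<times> {0..t}) = measure lborel K + t * measure lborel (fst ` K)"
proof -
  have cfst: "compact (fst ` K)"
    using K(1) by (intro compact_continuous_image continuous_intros)
  have csum: "compact (K + {0} \<times> {0..t})"
    using K(1) by (simp add: compact_Times compact_set_plus)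
  have slice: "emeasure lborel (Pair x -` (K + {0} \<times> {0..t}))
      = emeasure lborel (Pair x -` K) + ennreal t * indicator (fst ` K) x" for x
  proof (cases "x \<in> fst ` K")
    case True
    have "compact (Pair x -` K)"
    proof -
      have "Pair x -` K = snd ` (K \<inter> {x} \<times> UNIV)" by (auto intro: rev_image_eqI)
      moreover have "compact (K \<inter> {x} \<times> UNIV)"
        using K(1) by (intro compact_Int_closed closed_Times) auto
      ultimately show ?thesis by (simp add: compact_continuous_image continuous_on_snd)
    qed
    moreover have "convex (Pair x -` K)"
    proof (rule convexI)
      fix y z a b :: real
      assume yz: "y \<in> Pair x -` K" "z \<in> Pair x -` K" and ab: "0 \<le> a" "0 \<le> b" "a + b = 1"
      then have "a *\<^sub>R (x, y) + b *\<^sub>R (x, z) \<in> K"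
        by (intro convexD[OF K(2)]) auto
      moreover have "a *\<^sub>R (x, y) + b *\<^sub>R (x, z) = (x, a *\<^sub>R y + b *\<^sub>R z)"
        using ab by (simp flip: scaleR_add_left)
      ultimately show "a *\<^sub>R y + b *\<^sub>R z \<in> Pair x -` K" by simp
    qed
    ultimately obtain c d where cd: "Pair x -` K = {c..d}"
      by (metis connected_compact_interval_1 convex_connected cbox_interval)
    from True have "Pair x -` K \<noteq> {}" by force
    with cd have le: "c \<le> d" by simp
    have "Pair x -` (K + {0} \<times> {0..t}) = {c..d + t}"
    proof (intro equalityI subsetI)
      fix y assume "y \<in> Pair x -` (K + {0} \<times> {0..t})"
      then obtain k s where "(x, k) \<in> K" "0 \<le> s" "s \<le> t" "y = k + s"
        by (auto simp: set_plus_def)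
      then show "y \<in> {c..d + t}" using cd
        by (metis add_increasing2 add_mono atLeastAtMost_iff vimageI2)
    next
      fix y assume y: "y \<in> {c..d + t}"
      \<comment> \<open>The highest point of the fibre \<open>{c..d}\<close> that is not above
        \<open>y\<close>; the remainder \<open>y - k\<close> then lies in
        \<open>{0..t}\<close>.\<close>
      define k where "k = min y d"
      have "k \<in> Pair x -` K" unfolding cd k_def using y le by auto
      then have "(x, k) + (0, y - k) \<in> K + {0} \<times> {0..t}"
        using y t by (intro set_plus_intro) (auto simp: k_def)
      then show "y \<in> Pair x -` (K + {0} \<times> {0..t})" by simp
    qed
    then show ?thesis using True cd le t by (simp flip: ennreal_plus)
  next
    case False
    then have "Pair x -` (K + {0} \<times> {0..t}) = {}" "Pair x -` K = {}"
      by (force simp: set_plus_def)+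
    then show ?thesis using False by simp
  qed
  have "emeasure lborel (K + {0} \<times> {0..t})
      = (\<integral>\<^sup>+ x. emeasure lborel (Pair x -` K) + ennreal t * indicator (fst ` K) x \<partial>lborel)"
    by (subst emeasure_lborel_compact_fubini(1)[OF csum]) (simp only: slice)
  also have "\<dots> = (\<integral>\<^sup>+ x. emeasure lborel (Pair x -` K) \<partial>lborel) + ennreal t * emeasure lborel (fst ` K)"
  proof -
    have "K \<in> sets (lborel \<Otimes>\<^sub>M lborel)"
      using K unfolding lborel_prod by (simp add: borel_compact)
    then have "(\<lambda>x. emeasure lborel (Pair x -` K)) \<in> borel_measurable lborel"
      by (rule lborel.measurable_emeasure_Pair)
    moreover have "fst ` K \<in> sets lborel" using cfst by (simp add: borel_compact)
    ultimately show ?thesis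
      by (subst nn_integral_add) (auto simp: nn_integral_cmult_indicator)
  qed
  also have "\<dots> = emeasure lborel K + ennreal t * emeasure lborel (fst ` K)"
    using emeasure_lborel_compact_fubini(1)[OF K(1)] by simp
  finally show ?thesis
    using csum cfst K(1) t by (simp add: emeasure_lborel_compact_eq_measure flip: ennreal_mult ennreal_plus)
qed

text \<open>The slice at height \<open>s\<close> is merely translated by
  \<open>s *\<^sub>R p\<close>, so all slices keep their measure.\<close>

lemma measure_shear:
  fixes K :: "('a::euclidean_space \<times> real) set"
  assumes "compact K"
  shows "measure lborel ((\<lambda>(x, s). (x + s *\<^sub>R p, s)) ` K) = measure lborel K"
proof -
  have c: "compact ((\<lambda>(x, s). (x + s *\<^sub>R p, s)) ` K)"
    using assms by (intro compact_continuous_image) (auto intro!: continuous_intros simp: case_prod_unfold)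
  have "compact ((\<lambda>x. (x, s)) -` K)" for s
  proof -
    have "(\<lambda>x. (x, s)) -` K = fst ` (K \<inter> UNIV \<times> {s})" by (auto intro: rev_image_eqI)
    moreover have "compact (K \<inter> UNIV \<times> {s})"
      using assms by (intro compact_Int_closed closed_Times) auto
    ultimately show ?thesis by (simp add: compact_continuous_image continuous_on_fst)
  qed
  moreover have "(\<lambda>x. (x, s)) -` ((\<lambda>(x, s). (x + s *\<^sub>R p, s)) ` K) = (\<lambda>x. x + s *\<^sub>R p) ` ((\<lambda>x. (x, s)) -` K)" for s
    by (auto intro: rev_image_eqI)
  ultimately have "emeasure lborel ((\<lambda>(x, s). (x + s *\<^sub>R p, s)) ` K) = emeasure lborel K"
    unfolding emeasure_lborel_compact_fubini(2)[OF c] emeasure_lborel_compact_fubini(2)[OF assms]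
    by (simp add: emeasure_lborel_compact_translation)
  then show ?thesis by (simp add: measure_def)
qed

text \<open>Moves volumes between \<open>real^n\<close> and iterated products, which are different
  types with matching bases. Such a map carries boxes to boxes with permuted side lengths, and box
  volumes determine \<open>lborel\<close>.\<close>

lemma measure_lborel_basis_map:
  fixes T :: "'a::euclidean_space \<Rightarrow> 'b::euclidean_space"
  assumes T: "linear T" and bij: "bij_betw T Basis Basis" and "compact K"
  shows "measure lborel (T ` K) = measure lborel K"
proof -
  have inner_T: "T x \<bullet> T b = x \<bullet> b" if "b \<in> Basis" for x b
  proof -
    have "T x = (\<Sum>c\<in>Basis. (x \<bullet> c) *\<^sub>R T c)"
      by (metis (no_types, lifting) T euclidean_representation linear_scale linear_sum sum.cong)
    then have "T x \<bullet> T b = (\<Sum>c\<in>Basis. (x \<bullet> c) * (T c \<bullet> T b))"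
      by (simp add: inner_sum_left)
    also have "\<dots> = (\<Sum>c\<in>Basis. (if c = b then x \<bullet> c else 0))"
    proof (rule sum.cong)
      fix c :: 'a assume c: "c \<in> Basis"
      have "T c \<in> Basis" "T b \<in> Basis" "T c = T b \<longleftrightarrow> c = b"
        using bij_betwE[OF bij] inj_on_eq_iff[OF bij_betw_imp_inj_on[OF bij]] that c by simp_all
      then show "(x \<bullet> c) * (T c \<bullet> T b) = (if c = b then x \<bullet> c else 0)"
        by (simp add: inner_Basis)
    qed simp
    also have "\<dots> = x \<bullet> b"
      using that by simp
    finally show ?thesis .
  qed
  have mT: "T \<in> borel_measurable borel"
    by (rule borel_measurable_continuous_onI, rule linear_continuous_on)
      (use T in \<open>simp add: linear_conv_bounded_linear\<close>)
  have B: "Basis = T ` Basis" using bij by (simp add: bij_betw_def)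
  have distr: "lborel = distr lborel borel T"
  proof (rule lborel_eqI)
    fix l u :: 'b assume lu: "\<And>b. b \<in> Basis \<Longrightarrow> l \<bullet> b \<le> u \<bullet> b"
    define l' u' where "l' = (\<Sum>b\<in>Basis. (l \<bullet> T b) *\<^sub>R b)" and "u' = (\<Sum>b\<in>Basis. (u \<bullet> T b) *\<^sub>R b)"
    have l': "l' \<bullet> b = l \<bullet> T b" "u' \<bullet> b = u \<bullet> T b" if "b \<in> Basis" for b
      using that by (simp_all add: l'_def u'_def)
    have "T -` box l u = box l' u'"
      unfolding box_def by (subst B) (auto simp: l' inner_T)
    then have "emeasure (distr lborel borel T) (box l u) = emeasure lborel (box l' u')"
      using mT by (simp add: emeasure_distr)
    also have "\<dots> = ennreal (\<Prod>b\<in>Basis. (u' - l') \<bullet> b)"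
      using lu bij by (subst emeasure_lborel_box) (auto simp: l' bij_betwE)
    also have "(\<Prod>b\<in>Basis. (u' - l') \<bullet> b) = (\<Prod>b\<in>Basis. (u - l) \<bullet> T b)"
      by (intro prod.cong) (auto simp: l' inner_diff_left)
    also have "\<dots> = (\<Prod>b\<in>Basis. (u - l) \<bullet> b)"
      using bij by (rule prod.reindex_bij_betw)
    finally show "emeasure (distr lborel borel T) (box l u) = ennreal (\<Prod>b\<in>Basis. (u - l) \<bullet> b)" .
  qed simp
  have inj: "inj T"
    unfolding linear_injective_0[OF T]
  proof (intro allI impI)
    fix x assume "T x = 0"
    then show "x = 0" using inner_T[of _ x] by (auto intro: euclidean_eqI[of x 0])
  qed
  have "T ` K \<in> sets borel"
    using compact_linear_image[OF T assms(3)] by (rule borel_compact)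
  then have "emeasure (distr lborel borel T) (T ` K) = emeasure lborel (T -` (T ` K))"
    using mT by (subst emeasure_distr) auto
  then have "emeasure lborel (T ` K) = emeasure lborel K"
    unfolding distr[symmetric] inj_vimage_image_eq[OF inj] .
  then show ?thesis by (simp add: measure_def)
qed

subsection \<open>Determinant sums of weighted planar points\<close>

text \<open>Twice the signed area of the triangle on the points \<open>i\<close>, \<open>j\<close>,
  \<open>k\<close>, that is, the determinant with rows \<open>(x, y, 1)\<close>.\<close>

definition tri_det :: "('i \<Rightarrow> real) \<Rightarrow> ('i \<Rightarrow> real) \<Rightarrow> 'i \<Rightarrow> 'i \<Rightarrow> 'i \<Rightarrow> real" where
  "tri_det x y i j k = (x j - x i) * (y k - y i) - (x k - x i) * (y j - y i)"

text \<open>Unnormalised and over ordered tuples: if G is the total weight, \<open>pair_sum\<close>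
  and \<open>triple_sum\<close> are G^2 and G^3 times the expectations. This accounts for the extra
  factor G in the inequality below.\<close>

definition pair_sum :: "'i set \<Rightarrow> ('i \<Rightarrow> real) \<Rightarrow> ('i \<Rightarrow> real) \<Rightarrow> real" where
  "pair_sum I z x = (\<Sum>i\<in>I. \<Sum>j\<in>I. z i * z j * \<bar>x i - x j\<bar>)"

definition triple_sum :: "'i set \<Rightarrow> ('i \<Rightarrow> real) \<Rightarrow> ('i \<Rightarrow> real) \<Rightarrow> ('i \<Rightarrow> real) \<Rightarrow> real" where
  "triple_sum I z x y = (\<Sum>i\<in>I. \<Sum>j\<in>I. \<Sum>k\<in>I. z i * z j * z k * \<bar>tri_det x y i j k\<bar>)"

text \<open>Writes the numbers in \<open>X\<close> as a constant plus a nonnegative combination of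
  threshold indicators. The levels are the elements of \<open>X\<close> other than the largest, each
  weighted by the gap to its successor.\<close>

lemma layer_cake:
  fixes X :: "real set"
  assumes "finite X"
  obtains L w c where "finite L" "\<And>s::real. 0 \<le> w s"
    "\<And>x. x \<in> X \<Longrightarrow> c + (\<Sum>s\<in>L. w s * of_bool (s < x)) = x"
proof -
  \<comment> \<open>Keeping every level inside \<open>X\<close> and strictly below some element of
    \<open>X\<close> makes \<open>L\<close> finite and ensures that the old maximum is not yet a
    level.\<close>
  have "\<exists>L w c. (\<forall>s\<in>L. s \<in> X \<and> (\<exists>x\<in>X. s < x)) \<and> (\<forall>s::real. 0 \<le> w s) \<and>
      (\<forall>x\<in>X. c + (\<Sum>s\<in>L. w s * of_bool (s < x)) = x)"
    using assms
  proof (induction rule: finite_linorder_max_induct)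
    case empty
    show ?case by (rule exI[of _ "{}"], rule exI[of _ "\<lambda>_. 0"]) simp
  next
    case (insert b X)
    obtain L w c where L: "\<forall>s\<in>L. s \<in> X \<and> (\<exists>x\<in>X. s < x)" and w: "\<forall>s. 0 \<le> w s"
      and c: "\<forall>x\<in>X. c + (\<Sum>s\<in>L. w s * of_bool (s < x)) = x"
      using insert.IH by (elim exE conjE) (rule that)
    note L = bspec[OF L] and w = spec[OF w] and c = bspec[OF c]
    show ?case
    proof (cases "X = {}")
      case True
      then show ?thesis by (intro exI[of _ "{}"] exI[of _ "\<lambda>_. 0"] exI[of _ b]) simp
    next
      case False
      define m where "m = Max X"
      have m: "m \<in> X" "\<And>x. x \<in> X \<Longrightarrow> x \<le> m" using False insert.hyps by (auto simp: m_def)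
      have mb: "m < b" using m(1) insert.hyps by blast
      have "L \<subseteq> X" using L by blast
      then have fin: "finite L" using insert.hyps finite_subset by blast
      have mL: "m \<notin> L" using L[of m] m(2) by force
      have Lm: "s < m" if "s \<in> L" for s using L[OF that] m(2) by force
      \<comment> \<open>The old maximum \<open>m\<close> becomes a level; among the points of
        \<open>insert b X\<close> only \<open>b\<close> exceeds it, so the old values do not
        change.\<close>
      define w' where "w' = w(m := b - m)"
      have eq: "(\<Sum>s\<in>insert m L. w' s * of_bool (s < x))
          = (\<Sum>s\<in>L. w s * of_bool (s < x)) + (b - m) * of_bool (m < x)" for x
      proof -
        have "(\<Sum>s\<in>L. w' s * of_bool (s < x)) = (\<Sum>s\<in>L. w s * of_bool (s < x))"
          using mL by (intro sum.cong) (auto simp: w'_def)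
        then show ?thesis using fin mL by (simp add: w'_def)
      qed
      have "(\<Sum>s\<in>L. w s * of_bool (s < b)) = (\<Sum>s\<in>L. w s * of_bool (s < m))"
        using mb Lm by (intro sum.cong) force+
      then have top: "c + (\<Sum>s\<in>L. w s * of_bool (s < b)) = m"
        by (simp only: c[OF m(1)])
      have "c + (\<Sum>s\<in>insert m L. w' s * of_bool (s < x)) = x" if "x \<in> insert b X" for x
        unfolding eq
      proof (cases "x = b")
        case True
        then show "c + ((\<Sum>s\<in>L. w s * of_bool (s < x)) + (b - m) * of_bool (m < x)) = x"
          using top mb by simp
      next
        case False
        with that have "x \<in> X" by simp
        moreover from this have "\<not> m < x" using m(2) by force
        ultimately show "c + ((\<Sum>s\<in>L. w s * of_bool (s < x)) + (b - m) * of_bool (m < x)) = x"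
          using c[of x] by (simp only: of_bool_eq mult_zero_right add_0_right)
      qed
      note eq_b = this
      have w'_nonneg: "0 \<le> w' s" for s using w mb by (simp add: w'_def)
      have L': "s \<in> insert b X \<and> (\<exists>x\<in>insert b X. s < x)" if "s \<in> insert m L" for s
        using that m(1) mb L[of s] by auto
      show ?thesis
        by (rule exI[of _ "insert m L"], rule exI[of _ w'], rule exI[of _ c])
          (intro conjI ballI allI L' w'_nonneg eq_b)
    qed
  qed
  then obtain L w c where L: "\<forall>s\<in>L. s \<in> X \<and> (\<exists>x\<in>X. s < x)" and w: "\<forall>s. 0 \<le> w s"
      and c: "\<forall>x\<in>X. c + (\<Sum>s\<in>L. w s * of_bool (s < x)) = x"
    by (elim exE conjE) (rule that)
  have "L \<subseteq> X" using L by blast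
  then show ?thesis
    using that[OF finite_subset[OF _ assms] spec[OF w] bspec[OF c]] by simp
qed

lemma sum_split_bool_classes:
  fixes z :: "'i \<Rightarrow> real" and g :: "bool \<Rightarrow> bool \<Rightarrow> real"
  assumes "finite I"
  shows "(\<Sum>i\<in>I. z i * g (a i) (b i))
    = (\<Sum>i\<in>I. z i * of_bool (\<not> a i \<and> \<not> b i)) * g False False
    + (\<Sum>i\<in>I. z i * of_bool (a i \<and> \<not> b i)) * g True False
    + (\<Sum>i\<in>I. z i * of_bool (\<not> a i \<and> b i)) * g False True
    + (\<Sum>i\<in>I. z i * of_bool (a i \<and> b i)) * g True True"
  unfolding sum_distrib_right sum.distrib[symmetric] by (intro sum.cong) auto

text \<open>Equality holds exactly when \<open>\<alpha> \<delta> = \<beta> \<gamma>\<close>, that is, for products of two measures on \<open>{0, 1}\<close>.\<close>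

lemma triple_sum_bool:
  fixes z :: "'i \<Rightarrow> real" and a b :: "'i \<Rightarrow> bool"
  assumes "finite I"
  shows "2 * (\<Sum>i\<in>I. z i) * triple_sum I z (of_bool \<circ> a) (of_bool \<circ> b)
    \<le> 3 * (pair_sum I z (of_bool \<circ> a) * pair_sum I z (of_bool \<circ> b))"
proof -
  define \<alpha> where "\<alpha> = (\<Sum>i\<in>I. z i * of_bool (\<not> a i \<and> \<not> b i))"
  define \<beta> where "\<beta> = (\<Sum>i\<in>I. z i * of_bool (a i \<and> \<not> b i))"
  define \<gamma> where "\<gamma> = (\<Sum>i\<in>I. z i * of_bool (\<not> a i \<and> b i))"
  define \<delta> where "\<delta> = (\<Sum>i\<in>I. z i * of_bool (a i \<and> b i))"
  \<comment> \<open>Integration over the four corners of the unit square against the class masses.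
    Nested copies of \<open>E\<close> replace the sums over indices, so every quantity becomes a
    polynomial in four variables.\<close>
  define E where "E g = \<alpha> * g False False + \<beta> * g True False + \<gamma> * g False True + \<delta> * g True True"
    for g :: "bool \<Rightarrow> bool \<Rightarrow> real"
  have split: "(\<Sum>i\<in>I. z i * g (a i) (b i)) = E g" for g
    unfolding E_def \<alpha>_def \<beta>_def \<gamma>_def \<delta>_def by (rule sum_split_bool_classes[OF assms])
  have G: "(\<Sum>i\<in>I. z i) = \<alpha> + \<beta> + \<gamma> + \<delta>"
    using split[of "\<lambda>_ _. 1"] by (simp add: E_def)
  define f where "f p q p' q' p'' q'' =
     \<bar>(of_bool p' - of_bool p) * (of_bool q'' - of_bool q) - (of_bool p'' - of_bool p) * (of_bool q' - of_bool q) :: real\<bar>"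
    for p q p' q' p'' q'' :: bool
  have "triple_sum I z (of_bool \<circ> a) (of_bool \<circ> b)
      = (\<Sum>i\<in>I. z i * (\<Sum>j\<in>I. z j * (\<Sum>k\<in>I. z k * f (a i) (b i) (a j) (b j) (a k) (b k))))"
    unfolding triple_sum_def tri_det_def f_def sum_distrib_left by (simp add: mult.assoc)
  also have "\<dots> = (\<Sum>i\<in>I. z i * (\<Sum>j\<in>I. z j * E (f (a i) (b i) (a j) (b j))))"
    by (simp only: split[of "f (a _) (b _) (a _) (b _)"])
  also have "\<dots> = (\<Sum>i\<in>I. z i * E (\<lambda>p' q'. E (f (a i) (b i) p' q')))"
    by (simp only: split[of "\<lambda>p' q'. E (f (a _) (b _) p' q')"])
  also have "\<dots> = E (\<lambda>p q. E (\<lambda>p' q'. E (f p q p' q')))"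
    by (simp only: split[of "\<lambda>p q. E (\<lambda>p' q'. E (f p q p' q'))"])
  \<comment> \<open>The determinant vanishes when two corners coincide and is 1 in absolute value on
    any three distinct corners of the square. Each of the four choices of three corners occurs in 6
    orders.\<close>
  also have "\<dots> = 6 * (\<beta> * \<gamma> * \<delta> + \<alpha> * \<gamma> * \<delta> + \<alpha> * \<beta> * \<delta> + \<alpha> * \<beta> * \<gamma>)"
    unfolding E_def f_def by (simp add: algebra_simps)
  finally have T: "triple_sum I z (of_bool \<circ> a) (of_bool \<circ> b) = \<dots>" .
  define e where "e p q = \<bar>of_bool p - of_bool q :: real\<bar>" for p q :: bool
  have "pair_sum I z (of_bool \<circ> c) = (\<Sum>i\<in>I. z i * (\<Sum>j\<in>I. z j * e (c i) (c j)))" for c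
    unfolding pair_sum_def sum_distrib_left by (simp add: mult.assoc e_def)
  note pair = this
  have A: "pair_sum I z (of_bool \<circ> a) = 2 * ((\<beta> + \<delta>) * (\<alpha> + \<gamma>))"
    unfolding pair split[of "\<lambda>p _. e (a _) p"] split[of "\<lambda>p _. E (\<lambda>p' _. e p p')"]
    unfolding E_def e_def by (simp add: algebra_simps)
  have B: "pair_sum I z (of_bool \<circ> b) = 2 * ((\<gamma> + \<delta>) * (\<alpha> + \<beta>))"
    unfolding pair split[of "\<lambda>_ p. e (b _) p"] split[of "\<lambda>_ p. E (\<lambda>_ p'. e p p')"]
    unfolding E_def e_def by (simp add: algebra_simps)
  have "3 * (pair_sum I z (of_bool \<circ> a) * pair_sum I z (of_bool \<circ> b))
      - 2 * (\<Sum>i\<in>I. z i) * triple_sum I z (of_bool \<circ> a) (of_bool \<circ> b) = 12 * (\<alpha> * \<delta> - \<beta> * \<gamma>)^2"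
    unfolding A B T G by (simp add: algebra_simps power2_eq_square)
  then show ?thesis by (smt (verit) zero_le_power2)
qed

section \<open>Decomposing the sums into layers\<close>

lemma pair_sum_product:
  "pair_sum I z x = (\<Sum>p\<in>I\<times>I. z (fst p) * z (snd p) * \<bar>x (fst p) - x (snd p)\<bar>)"
  by (simp add: pair_sum_def sum.cartesian_product case_prod_unfold)

lemma triple_sum_product:
  "triple_sum I z x y = (\<Sum>p\<in>I\<times>I\<times>I. z (fst p) * z (fst (snd p)) * z (snd (snd p))
     * \<bar>tri_det x y (fst p) (fst (snd p)) (snd (snd p))\<bar>)"
  by (simp add: triple_sum_def sum.cartesian_product case_prod_unfold)

lemma pair_sum_decompose:
  assumes "\<And>i j. i \<in> I \<Longrightarrow> j \<in> I \<Longrightarrow> \<bar>x i - x j\<bar> = (\<Sum>s\<in>L. w s * \<bar>h s i - h s j\<bar>)"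
  shows "pair_sum I z x = (\<Sum>s\<in>L. w s * pair_sum I z (h s))"
proof -
  have "pair_sum I z x
      = (\<Sum>p\<in>I\<times>I. \<Sum>s\<in>L. w s * (z (fst p) * z (snd p) * \<bar>h s (fst p) - h s (snd p)\<bar>))"
    unfolding pair_sum_product
    by (intro sum.cong) (auto simp: assms sum_distrib_left mult_ac)
  also have "\<dots> = (\<Sum>s\<in>L. w s * pair_sum I z (h s))"
    by (subst sum.swap) (simp add: pair_sum_product sum_distrib_left)
  finally show ?thesis .
qed

text \<open>\<open>tri_det\<close> is bilinear in \<open>x\<close> and \<open>y\<close>, so the
  triangle inequality bounds the triple sum by those of the layers, whereas the pair sums split
  exactly. Each pair of layers has values in {0, 1} and falls under
  \<open>triple_sum_bool\<close>.\<close>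

lemma triple_sum_le_pair_sums:
  fixes z x y :: "'i \<Rightarrow> real"
  assumes I: "finite I" and z: "\<And>i. i \<in> I \<Longrightarrow> 0 \<le> z i"
  shows "2 * (\<Sum>i\<in>I. z i) * triple_sum I z x y \<le> 3 * (pair_sum I z x * pair_sum I z y)"
proof -
  obtain L w c where L: "finite L" and w: "\<And>s::real. 0 \<le> w s"
    and x: "\<And>t. t \<in> x ` I \<Longrightarrow> c + (\<Sum>s\<in>L. w s * of_bool (s < t)) = t"
    using layer_cake[of "x ` I"] I by blast
  obtain L' w' c' where L': "finite L'" and w': "\<And>s::real. 0 \<le> w' s"
    and y: "\<And>t. t \<in> y ` I \<Longrightarrow> c' + (\<Sum>s\<in>L'. w' s * of_bool (s < t)) = t"
    using layer_cake[of "y ` I"] I by blast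
  define h :: "real \<Rightarrow> 'i \<Rightarrow> real" where "h s = of_bool \<circ> (\<lambda>i. s < x i)" for s
  define h' :: "real \<Rightarrow> 'i \<Rightarrow> real" where "h' s = of_bool \<circ> (\<lambda>i. s < y i)" for s
  have dx: "x j - x i = (\<Sum>s\<in>L. w s * (h s j - h s i))" if "i \<in> I" "j \<in> I" for i j
  proof -
    have "x j - x i = (c + (\<Sum>s\<in>L. w s * of_bool (s < x j))) - (c + (\<Sum>s\<in>L. w s * of_bool (s < x i)))"
      by (rule arg_cong2[where f = "(-)"]) (intro x[symmetric] imageI that)+
    also have "\<dots> = (\<Sum>s\<in>L. w s * (h s j - h s i))"
      by (simp add: h_def right_diff_distrib sum_subtractf)
    finally show ?thesis .
  qed
  have dy: "y j - y i = (\<Sum>s\<in>L'. w' s * (h' s j - h' s i))" if "i \<in> I" "j \<in> I" for i j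
  proof -
    have "y j - y i = (c' + (\<Sum>s\<in>L'. w' s * of_bool (s < y j))) - (c' + (\<Sum>s\<in>L'. w' s * of_bool (s < y i)))"
      by (rule arg_cong2[where f = "(-)"]) (intro y[symmetric] imageI that)+
    also have "\<dots> = (\<Sum>s\<in>L'. w' s * (h' s j - h' s i))"
      by (simp add: h'_def right_diff_distrib sum_subtractf)
    finally show ?thesis .
  qed
  \<comment> \<open>Every layer \<open>h s\<close> is a nondecreasing function of \<open>x\<close>,
    so all increments between two points have the same sign and the absolute value passes inside the
    sum with equality.\<close>
  have abs_dx: "\<bar>x i - x j\<bar> = (\<Sum>s\<in>L. w s * \<bar>h s i - h s j\<bar>)" if "i \<in> I" "j \<in> I" for i j
  proof (cases "x j \<le> x i")
    case True
    then show ?thesis unfolding dx[OF that(2,1)]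
      by (subst abs_of_nonneg) (auto simp: h_def intro!: sum_nonneg sum.cong w mult_nonneg_nonneg)
  next
    case False
    then show ?thesis unfolding abs_minus_commute[of "x i"] dx[OF that]
      by (subst abs_of_nonneg) (auto simp: h_def intro!: sum_nonneg sum.cong w mult_nonneg_nonneg)
  qed
  have abs_dy: "\<bar>y i - y j\<bar> = (\<Sum>s\<in>L'. w' s * \<bar>h' s i - h' s j\<bar>)" if "i \<in> I" "j \<in> I" for i j
  proof (cases "y j \<le> y i")
    case True
    then show ?thesis unfolding dy[OF that(2,1)]
      by (subst abs_of_nonneg) (auto simp: h'_def intro!: sum_nonneg sum.cong w' mult_nonneg_nonneg)
  next
    case False
    then show ?thesis unfolding abs_minus_commute[of "y i"] dy[OF that]
      by (subst abs_of_nonneg) (auto simp: h'_def intro!: sum_nonneg sum.cong w' mult_nonneg_nonneg)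
  qed
  have px: "pair_sum I z x = (\<Sum>s\<in>L. w s * pair_sum I z (h s))"
    by (rule pair_sum_decompose) (rule abs_dx)
  have py: "pair_sum I z y = (\<Sum>s\<in>L'. w' s * pair_sum I z (h' s))"
    by (rule pair_sum_decompose) (rule abs_dy)
  have tri: "tri_det x y i j k = (\<Sum>s\<in>L. \<Sum>t\<in>L'. w s * w' t * tri_det (h s) (h' t) i j k)"
    if "i \<in> I" "j \<in> I" "k \<in> I" for i j k
    unfolding tri_det_def using that
    by (simp add: dx dy sum_product flip: sum_subtractf) (simp add: algebra_simps)
  have tri_le: "\<bar>tri_det x y i j k\<bar> \<le> (\<Sum>s\<in>L. \<Sum>t\<in>L'. w s * w' t * \<bar>tri_det (h s) (h' t) i j k\<bar>)"
    if "i \<in> I" "j \<in> I" "k \<in> I" for i j k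
    unfolding tri[OF that]
    by (intro order_trans[OF sum_abs] sum_mono) (simp add: abs_mult w w')
  have "triple_sum I z x y \<le> (\<Sum>s\<in>L. \<Sum>t\<in>L'. w s * w' t * triple_sum I z (h s) (h' t))"
  proof -
    \<comment> \<open>Triples are packed into one index, so that two exchanges of summation bring
      the layers outside.\<close>
    define Z where "Z p = z (fst p) * z (fst (snd p)) * z (snd (snd p))" for p
    define D where "D x y p = \<bar>tri_det x y (fst p) (fst (snd p)) (snd (snd p))\<bar>" for x y and p :: "'i \<times> 'i \<times> 'i"
    have T: "triple_sum I z x y = (\<Sum>p\<in>I\<times>I\<times>I. Z p * D x y p)" for x y
      unfolding triple_sum_product Z_def D_def ..
    have "triple_sum I z x y
        \<le> (\<Sum>p\<in>I\<times>I\<times>I. Z p * (\<Sum>s\<in>L. \<Sum>t\<in>L'. w s * w' t * D (h s) (h' t) p))"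
      unfolding T by (intro sum_mono mult_left_mono) (auto simp: Z_def D_def z intro: tri_le)
    also have "\<dots> = (\<Sum>s\<in>L. \<Sum>p\<in>I\<times>I\<times>I. \<Sum>t\<in>L'. w s * w' t * (Z p * D (h s) (h' t) p))"
      by (subst sum.swap) (simp add: sum_distrib_left mult_ac)
    also have "\<dots> = (\<Sum>s\<in>L. \<Sum>t\<in>L'. \<Sum>p\<in>I\<times>I\<times>I. w s * w' t * (Z p * D (h s) (h' t) p))"
      by (intro sum.cong refl sum.swap)
    also have "\<dots> = (\<Sum>s\<in>L. \<Sum>t\<in>L'. w s * w' t * triple_sum I z (h s) (h' t))"
      by (simp add: T sum_distrib_left)
    finally show ?thesis .
  qed
  then have "2 * (\<Sum>i\<in>I. z i) * triple_sum I z x y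
      \<le> 2 * (\<Sum>i\<in>I. z i) * (\<Sum>s\<in>L. \<Sum>t\<in>L'. w s * w' t * triple_sum I z (h s) (h' t))"
    using z by (intro mult_left_mono) (auto intro: sum_nonneg)
  also have "\<dots> = (\<Sum>s\<in>L. \<Sum>t\<in>L'. w s * w' t * (2 * (\<Sum>i\<in>I. z i) * triple_sum I z (h s) (h' t)))"
    by (simp add: sum_distrib_left mult_ac)
  also have "\<dots> \<le> (\<Sum>s\<in>L. \<Sum>t\<in>L'. w s * w' t * (3 * (pair_sum I z (h s) * pair_sum I z (h' t))))"
    using triple_sum_bool[OF I, of z]
    by (intro sum_mono mult_left_mono) (auto simp: h_def h'_def w w')
  also have "\<dots> = 3 * (pair_sum I z x * pair_sum I z y)"
    unfolding px py sum_product by (simp add: sum_distrib_left mult_ac)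
  finally show ?thesis .
qed

subsection \<open>Volumes of zonotopes\<close>

text \<open>Every zonotope is a translate of such a set, and volume ignores translations, so only
  the generators matter.\<close>

definition zono :: "(nat \<Rightarrow> 'a::real_vector) \<Rightarrow> nat \<Rightarrow> 'a set" where
  "zono g n = (\<Sum>i<n. closed_segment 0 (g i))"

lemma zono_0 [simp]: "zono g 0 = {0}"
  by (simp add: zono_def)

lemma zono_Suc: "zono g (Suc n) = zono g n + closed_segment 0 (g n)"
  by (simp add: zono_def)

lemma compact_zono: "compact (zono (g :: nat \<Rightarrow> 'a::euclidean_space) n)"
  by (induction n) (simp_all add: zono_Suc compact_set_plus)

lemma convex_zono: "convex (zono (g :: nat \<Rightarrow> 'a::euclidean_space) n)"
  by (induction n) (simp_all add: zono_Suc convex_set_plus)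

lemma zono_nonempty: "zono g n \<noteq> {}"
  by (induction n) (auto simp: zono_Suc set_plus_def)

lemma linear_image_set_plus:
  assumes "linear f"
  shows "f ` (A + B) = f ` A + f ` B"
  by (force simp: set_plus_def linear_add[OF assms] image_iff)

lemma linear_image_zono:
  assumes "linear f"
  shows "f ` zono g n = zono (f \<circ> g) n"
proof (induction n)
  case 0
  show ?case using linear_0[OF assms] by simp
next
  case (Suc n)
  show ?case
    using closed_segment_linear_image[OF assms, of 0 "g n"]
    by (simp add: zono_Suc linear_image_set_plus[OF assms] Suc linear_0[OF assms])
qed

lemma interval_set_plus:
  fixes a b c d :: real
  assumes "a \<le> b" "c \<le> d"
  shows "{a..b} + {c..d} = {a + c..b + d}"
proof (intro equalityI subsetI)
  fix y assume y: "y \<in> {a + c..b + d}"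
  define k where "k = min b (y - c)"
  have "k + (y - k) \<in> {a..b} + {c..d}"
    using y assms by (intro set_plus_intro) (auto simp: k_def min_def)
  then show "y \<in> {a..b} + {c..d}" by simp
qed (auto simp: set_plus_def)

lemma measure_zono_real:
  fixes r :: "nat \<Rightarrow> real"
  shows "measure lborel (zono r n) = (\<Sum>i<n. \<bar>r i\<bar>)"
proof -
  have "zono r n = {\<Sum>i<n. min 0 (r i)..\<Sum>i<n. max 0 (r i)}"
  proof (induction n)
    case (Suc n)
    have "closed_segment 0 (r n) = {min 0 (r n)..max 0 (r n)}"
      by (simp add: closed_segment_eq_real_ivl min_def max_def)
    moreover have "(\<Sum>i<n. min 0 (r i)) \<le> (\<Sum>i<n. max 0 (r i))" by (intro sum_mono) simp
    ultimately show ?case by (simp add: zono_Suc Suc interval_set_plus)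
  qed simp
  moreover have "(\<Sum>i<n. min 0 (r i)) \<le> (\<Sum>i<n. max 0 (r i))" by (intro sum_mono) simp
  moreover have "(\<Sum>i<n. max 0 (r i)) - (\<Sum>i<n. min 0 (r i)) = (\<Sum>i<n. \<bar>r i\<bar>)"
    unfolding sum_subtractf[symmetric] by (intro sum.cong) auto
  ultimately show ?thesis by simp
qed

text \<open>A volume-preserving shear makes the segment vertical. After it, \<open>fst\<close> is
  the projection of the original body along the direction \<open>(p, 1)\<close>.\<close>

lemma measure_add_segment_pos:
  fixes K :: "('a::euclidean_space \<times> real) set"
  assumes K: "compact K" "convex K" and t: "0 \<le> t"
  shows "measure lborel (K + closed_segment 0 (t *\<^sub>R p, t))
    = measure lborel K + t * measure lborel ((\<lambda>(x, s). x - s *\<^sub>R p) ` K)"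
proof -
  define S where "S = (\<lambda>(x :: 'a, s :: real). (x + s *\<^sub>R (- p), s))"
  have S: "linear S"
    unfolding S_def by (rule linearI) (auto simp: algebra_simps)
  have cK: "compact (S ` K)"
    by (rule compact_linear_image[OF S K(1)])
  have "measure lborel (K + closed_segment 0 (t *\<^sub>R p, t))
      = measure lborel (S ` (K + closed_segment 0 (t *\<^sub>R p, t)))"
    unfolding S_def using K by (subst measure_shear) (auto intro: compact_set_plus)
  also have "S ` (K + closed_segment 0 (t *\<^sub>R p, t)) = S ` K + closed_segment 0 (0, t)"
    using closed_segment_linear_image[OF S, of 0 "(t *\<^sub>R p, t)"]
    by (simp add: linear_image_set_plus[OF S] linear_0[OF S]) (simp add: S_def)
  also have "closed_segment 0 (0, t) = ({0} \<times> {0..t} :: ('a \<times> real) set)"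
  proof -
    have "linear (\<lambda>s. (0 :: 'a, s :: real))" by (rule linearI) auto
    then have "closed_segment (0 :: 'a, 0 :: real) (0, t) = (\<lambda>s. (0, s)) ` closed_segment 0 t"
      by (rule closed_segment_linear_image)
    then show ?thesis using t by (auto simp: closed_segment_eq_real_ivl zero_prod_def)
  qed
  also have "measure lborel (S ` K + {0} \<times> {0..t}) = measure lborel (S ` K) + t * measure lborel (fst ` S ` K)"
    using cK convex_linear_image[OF S K(2)] t by (rule measure_add_vertical_segment)
  also have "measure lborel (S ` K) = measure lborel K"
    unfolding S_def by (rule measure_shear[OF K(1)])
  also have "fst ` S ` K = (\<lambda>(x, s). x - s *\<^sub>R p) ` K"
    unfolding image_image by (simp add: S_def case_prod_unfold)
  finally show ?thesis .
qed

lemma measure_lborel_translation: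
  fixes K :: "'a::euclidean_space set"
  assumes "compact K"
  shows "measure lborel ((\<lambda>x. x + p) ` K) = measure lborel K"
  using emeasure_lborel_compact_translation[OF assms] by (simp add: measure_def)

text \<open>Reversing a generator only translates the sum, which reduces segments pointing down to
  segments pointing up.\<close>

lemma add_segment_minus:
  fixes K :: "'a::real_vector set"
  shows "K + closed_segment 0 (- a) = (\<lambda>x. x + (- a)) ` (K + closed_segment 0 a)"
proof -
  have "closed_segment 0 (- a) = (\<lambda>x. x + (- a)) ` closed_segment 0 a"
    using closed_segment_translation[of "- a" a 0]
    by (simp add: closed_segment_commute add.commute[of _ "- a"])
  then show ?thesis by (force simp: set_plus_def image_iff add.assoc)
qed

lemma measure_add_segment:
  fixes K :: "('a::euclidean_space \<times> real) set"
  assumes K: "compact K" "convex K"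
  shows "measure lborel (K + closed_segment 0 (t *\<^sub>R p, t))
    = measure lborel K + \<bar>t\<bar> * measure lborel ((\<lambda>(x, s). x - s *\<^sub>R p) ` K)"
proof (cases "0 \<le> t")
  case True
  then show ?thesis using measure_add_segment_pos[OF K] by simp
next
  case False
  have "K + closed_segment 0 (t *\<^sub>R p, t)
      = (\<lambda>x. x + (t *\<^sub>R p, t)) ` (K + closed_segment 0 ((- t) *\<^sub>R p, - t))"
    using add_segment_minus[of K "((- t) *\<^sub>R p, - t)"] by simp
  then show ?thesis
    using False measure_add_segment_pos[OF K, of "- t" p] K
    by (simp add: measure_lborel_translation compact_set_plus)
qed

section \<open>Determinant formulas in dimensions two and three\<close>

definition det2 :: "real \<times> real \<Rightarrow> real \<times> real \<Rightarrow> real" where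
  "det2 p q = fst p * snd q - fst q * snd p"

lemma measure_swap:
  fixes K :: "(real \<times> real) set"
  assumes "compact K"
  shows "measure lborel (prod.swap ` K) = measure lborel K"
proof (rule measure_lborel_basis_map[OF _ _ assms])
  show "linear (prod.swap :: real \<times> real \<Rightarrow> _)" by (rule linearI) auto
  have B: "Basis = {(1 :: real, 0 :: real), (0, 1)}" by (auto simp: Basis_prod_def)
  show "bij_betw prod.swap (Basis :: (real \<times> real) set) Basis"
    unfolding bij_betw_def B by (simp add: insert_commute)
qed

text \<open>Projection along \<open>a\<close> sends the generator \<open>q i\<close> to
  \<open>det2 (q i) a / snd a\<close>, and the length of a one-dimensional zonotope is the sum of
  the absolute values of its generators.\<close>

lemma measure_zono_planar_Suc_oblique:
  fixes q :: "nat \<Rightarrow> real \<times> real"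
  assumes "snd a \<noteq> 0"
  shows "measure lborel (zono q n + closed_segment 0 a) = measure lborel (zono q n) + (\<Sum>i<n. \<bar>det2 (q i) a\<bar>)"
proof -
  define t p where "t = snd a" and "p = fst a / snd a"
  define f where "f = (\<lambda>(x :: real, s). x - s *\<^sub>R p)"
  have f: "linear f" unfolding f_def by (rule linearI) (auto simp: algebra_simps)
  have a: "a = (t *\<^sub>R p, t)" using assms by (simp add: t_def p_def prod_eq_iff)
  have "\<bar>t\<bar> * measure lborel (f ` zono q n) = (\<Sum>i<n. \<bar>det2 (q i) a\<bar>)"
    unfolding linear_image_zono[OF f] measure_zono_real sum_distrib_left abs_mult[symmetric]
    by (intro sum.cong) (auto simp: f_def det2_def a case_prod_unfold algebra_simps)
  then show ?thesis
    using measure_add_segment[OF compact_zono convex_zono, of q n t p] unfolding a f_def by simp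
qed

text \<open>A nonzero horizontal \<open>a\<close> becomes oblique when the coordinates are
  exchanged, which changes neither areas nor absolute determinants.\<close>

lemma measure_zono_planar_Suc:
  fixes q :: "nat \<Rightarrow> real \<times> real"
  shows "measure lborel (zono q n + closed_segment 0 a) = measure lborel (zono q n) + (\<Sum>i<n. \<bar>det2 (q i) a\<bar>)"
proof (cases "snd a = 0")
  case True
  show ?thesis
  proof (cases "fst a = 0")
    case True
    with \<open>snd a = 0\<close> have "a = 0" by (simp add: prod_eq_iff)
    then show ?thesis by (simp add: det2_def)
  next
    case False
    have lin: "linear (prod.swap :: real \<times> real \<Rightarrow> _)" by (rule linearI) auto
    have sw: "prod.swap ` (zono q n + closed_segment 0 a)
        = zono (prod.swap \<circ> q) n + closed_segment 0 (prod.swap a)"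
      using closed_segment_linear_image[OF lin, of 0 a]
      by (simp add: linear_image_set_plus[OF lin] linear_image_zono[OF lin] linear_0[OF lin])
    have "measure lborel (zono q n + closed_segment 0 a)
        = measure lborel (prod.swap ` (zono q n + closed_segment 0 a))"
      by (simp add: measure_swap compact_set_plus compact_zono)
    also have "\<dots> = measure lborel (prod.swap ` zono q n) + (\<Sum>i<n. \<bar>det2 (prod.swap (q i)) (prod.swap a)\<bar>)"
      using False unfolding sw linear_image_zono[OF lin] by (subst measure_zono_planar_Suc_oblique) auto
    also have "\<dots> = measure lborel (zono q n) + (\<Sum>i<n. \<bar>det2 (q i) a\<bar>)"
      by (simp add: measure_swap compact_zono det2_def abs_minus_commute mult.commute)
    finally show ?thesis .
  qed
qed (rule measure_zono_planar_Suc_oblique)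

text \<open>Each new generator contributes its determinants with all earlier ones. The factor 2
  appears because ordered pairs are summed, the diagonal being zero.\<close>

lemma measure_zono_planar:
  fixes q :: "nat \<Rightarrow> real \<times> real"
  shows "2 * measure lborel (zono q n) = (\<Sum>i<n. \<Sum>j<n. \<bar>det2 (q i) (q j)\<bar>)"
proof (induction n)
  case (Suc n)
  have "\<bar>det2 (q i) (q j)\<bar> = \<bar>det2 (q j) (q i)\<bar>" for i j
    by (simp add: det2_def abs_minus_commute mult.commute)
  then have "(\<Sum>j<n. \<bar>det2 (q n) (q j)\<bar>) = (\<Sum>i<n. \<bar>det2 (q i) (q n)\<bar>)" by simp
  moreover have "det2 (q n) (q n) = 0" by (simp add: det2_def)
  ultimately show ?case
    using Suc by (simp add: zono_Suc measure_zono_planar_Suc sum.distrib)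
qed simp

lemma tri_det_perm:
  "\<bar>tri_det x y j i k\<bar> = \<bar>tri_det x y i j k\<bar>" "\<bar>tri_det x y i k j\<bar> = \<bar>tri_det x y i j k\<bar>"
proof -
  have "tri_det x y j i k = - tri_det x y i j k" "tri_det x y i k j = - tri_det x y i j k"
    by (simp_all add: tri_det_def algebra_simps)
  then show "\<bar>tri_det x y j i k\<bar> = \<bar>tri_det x y i j k\<bar>" "\<bar>tri_det x y i k j\<bar> = \<bar>tri_det x y i j k\<bar>"
    by simp_all
qed

text \<open>By symmetry the new index \<open>n\<close> contributes equally from each of the three
  positions; a triple that contains it twice has zero determinant.\<close>

lemma triple_sum_Suc:
  "triple_sum {..<Suc n} z x y = triple_sum {..<n} z x y
    + 3 * (\<Sum>i<n. \<Sum>j<n. z n * z i * z j * \<bar>tri_det x y n i j\<bar>)"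
proof -
  define F where "F i j k = z i * z j * z k * \<bar>tri_det x y i j k\<bar>" for i j k
  have F1: "F i n k = F n i k" for i k
    unfolding F_def tri_det_perm(1)[of x y i n k] by simp
  have F2: "F i j n = F n i j" for i j
    unfolding F_def tri_det_perm(2)[of x y i j n] tri_det_perm(1)[of x y n i j] by simp
  have F0: "F n n k = 0" "F n k n = 0" "F k n n = 0" for k by (simp_all add: F_def tri_det_def)
  have "(\<Sum>i<Suc n. \<Sum>j<Suc n. \<Sum>k<Suc n. F i j k)
      = (\<Sum>i<n. \<Sum>j<n. \<Sum>k<n. F i j k) + 3 * (\<Sum>i<n. \<Sum>j<n. F n i j)"
    by (simp add: sum.distrib F0) (simp add: F1 F2)
  then show ?thesis by (simp add: triple_sum_def F_def)
qed

text \<open>The last generator adds \<open>\<bar>z n\<bar>\<close> times the area of the projection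
  along it. That projection turns generator \<open>i\<close> into \<open>z i\<close> times the
  planar vector from point \<open>n\<close> to point \<open>i\<close>, whence triangles with vertex
  \<open>n\<close>. The factor 6 counts the orders of a triple.\<close>

lemma measure_zono_3d:
  fixes z x y :: "nat \<Rightarrow> real"
  shows "6 * measure lborel (zono (\<lambda>i. (z i *\<^sub>R (x i, y i), z i)) n) = triple_sum {..<n} (\<lambda>i. \<bar>z i\<bar>) x y"
proof (induction n)
  case 0
  show ?case by (simp add: triple_sum_def)
next
  case (Suc n)
  let ?g = "\<lambda>i. (z i *\<^sub>R (x i, y i), z i)"
  define f where "f = (\<lambda>(p :: real \<times> real, s). p - s *\<^sub>R (x n, y n))"
  have f: "linear f" unfolding f_def by (rule linearI) (auto simp: algebra_simps)
  have fg: "det2 ((f \<circ> ?g) i) ((f \<circ> ?g) j) = z i * z j * tri_det x y n i j" for i j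
    by (simp add: f_def det2_def tri_det_def algebra_simps)
  have "2 * measure lborel (f ` zono ?g n) = (\<Sum>i<n. \<Sum>j<n. \<bar>z i\<bar> * \<bar>z j\<bar> * \<bar>tri_det x y n i j\<bar>)"
    unfolding linear_image_zono[OF f] measure_zono_planar fg by (simp add: abs_mult)
  then have "6 * (\<bar>z n\<bar> * measure lborel (f ` zono ?g n))
      = 3 * (\<Sum>i<n. \<Sum>j<n. \<bar>z n\<bar> * \<bar>z i\<bar> * \<bar>z j\<bar> * \<bar>tri_det x y n i j\<bar>)"
    by (simp add: mult.assoc flip: sum_distrib_left)
  then show ?case
    unfolding zono_Suc triple_sum_Suc Suc[symmetric]
    using measure_add_segment[OF compact_zono convex_zono, of ?g n "z n" "(x n, y n)"]
    by (simp add: f_def)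
qed

subsection \<open>Hausdorff continuity of volume\<close>

text \<open>Hausdorff distance at most \<open>e\<close>, expressed by points so that it passes
  through linear maps and limits without suprema.\<close>

definition hausdorff_close :: "real \<Rightarrow> 'a::metric_space set \<Rightarrow> 'a set \<Rightarrow> bool" where
  "hausdorff_close e A B \<longleftrightarrow> (\<forall>a\<in>A. \<exists>b\<in>B. dist a b \<le> e) \<and> (\<forall>b\<in>B. \<exists>a\<in>A. dist a b \<le> e)"

text \<open>Compactness bounds the suprema and lets the distances to the other set be
  attained.\<close>

lemma hausdorff_close_hausdorff_dist:
  fixes A B :: "'a::euclidean_space set"
  assumes "compact A" "A \<noteq> {}" "compact B" "B \<noteq> {}"
  shows "hausdorff_close (hausdorff_dist A B) A B"
proof -
  have near: "\<exists>y\<in>Y. dist x y \<le> (SUP x\<in>X. infdist x Y)"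
    if XY: "compact X" "compact Y" "Y \<noteq> {}" "x \<in> X" for X Y and x :: 'a
  proof -
    have "compact ((\<lambda>x. infdist x Y) ` X)"
      using that by (intro compact_continuous_image continuous_intros)
    then have "infdist x Y \<le> (SUP x\<in>X. infdist x Y)"
      using that by (intro cSUP_upper bounded_imp_bdd_above compact_imp_bounded)
    moreover obtain y where "y \<in> Y" "infdist x Y = dist x y"
      using infdist_attains_inf[OF compact_imp_closed[OF XY(2)] XY(3)] by metis
    ultimately show ?thesis by auto
  qed
  have "\<exists>b\<in>B. dist a b \<le> hausdorff_dist A B" if "a \<in> A" for a
    using near[OF assms(1,3,4) that] unfolding hausdorff_dist_def by (auto simp: le_max_iff_disj)
  moreover have "\<exists>a\<in>A. dist a b \<le> hausdorff_dist A B" if "b \<in> B" for b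
    using near[OF assms(3,1,2) that] unfolding hausdorff_dist_def by (auto simp: le_max_iff_disj dist_commute)
  ultimately show ?thesis unfolding hausdorff_close_def by blast
qed

lemma hausdorff_close_linear_image:
  assumes "hausdorff_close e A B" "linear f" "\<And>x. norm (f x) \<le> C * norm x" "0 \<le> C"
  shows "hausdorff_close (C * e) (f ` A) (f ` B)"
proof -
  have "dist (f x) (f y) \<le> C * e" if "dist x y \<le> e" for x y
  proof -
    have "dist (f x) (f y) = norm (f (x - y))" using assms(2) by (simp add: dist_norm linear_diff)
    also have "\<dots> \<le> C * dist x y" using assms(3) by (simp add: dist_norm)
    also have "\<dots> \<le> C * e" using that assms(4) by (rule mult_left_mono)
    finally show ?thesis .
  qed
  note le = this
  show ?thesis
    unfolding hausdorff_close_def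
  proof (intro conjI ballI)
    fix p assume "p \<in> f ` A"
    then obtain a where "a \<in> A" "p = f a" by blast
    moreover from this obtain b where "b \<in> B" "dist a b \<le> e"
      using assms(1) unfolding hausdorff_close_def by blast
    ultimately show "\<exists>q\<in>f ` B. dist p q \<le> C * e" using le by blast
  next
    fix q assume "q \<in> f ` B"
    then obtain b where "b \<in> B" "q = f b" by blast
    moreover from this obtain a where "a \<in> A" "dist a b \<le> e"
      using assms(1) unfolding hausdorff_close_def by blast
    ultimately show "\<exists>p\<in>f ` A. dist p q \<le> C * e" using le by blast
  qed
qed

lemma convex_hausdorff_limit:
  fixes L :: "'a::euclidean_space set"
  assumes conv: "\<And>n. convex (K n)" and "closed L"
    and close: "\<And>n. hausdorff_close (e n) (K n) L" and e: "e \<longlonglongrightarrow> 0"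
  shows "convex L"
proof (rule convexI)
  fix x y :: 'a and u v :: real
  assume xy: "x \<in> L" "y \<in> L" and uv: "0 \<le> u" "0 \<le> v" "u + v = 1"
  let ?p = "u *\<^sub>R x + v *\<^sub>R y"
  \<comment> \<open>One \<open>e n\<close> pays for replacing \<open>x\<close> and \<open>y\<close>
    by points of \<open>K n\<close>, the other for returning from their convex combination to
    \<open>L\<close>.\<close>
  have "\<exists>z. z \<in> L \<and> dist z ?p \<le> e n + e n" for n
  proof -
    obtain x' y' where x': "x' \<in> K n" "dist x' x \<le> e n" and y': "y' \<in> K n" "dist y' y \<le> e n"
      using close[of n] xy unfolding hausdorff_close_def by blast
    let ?q = "u *\<^sub>R x' + v *\<^sub>R y'"
    have "?q \<in> K n" using conv x' y' uv by (simp add: convexD)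
    then obtain z where z: "z \<in> L" "dist ?q z \<le> e n"
      using close[of n] unfolding hausdorff_close_def by blast
    have "?q - ?p = u *\<^sub>R (x' - x) + v *\<^sub>R (y' - y)" by (simp add: algebra_simps)
    then have "dist ?q ?p \<le> u * dist x' x + v * dist y' y"
      using uv norm_triangle_ineq[of "u *\<^sub>R (x' - x)" "v *\<^sub>R (y' - y)"] by (simp add: dist_norm)
    also have "\<dots> \<le> u * e n + v * e n" using x' y' uv by (intro add_mono mult_left_mono) auto
    also have "\<dots> = e n" using uv by (simp flip: distrib_right)
    finally have "dist z ?p \<le> e n + e n" using z(2) dist_triangle3[of z ?p ?q] by linarith
    then show ?thesis using z(1) by blast
  qed
  then obtain z where z: "\<And>n. z n \<in> L" "\<And>n. dist (z n) ?p \<le> e n + e n" by metis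
  have lim: "(\<lambda>n. e n + e n) \<longlonglongrightarrow> 0" using tendsto_add[OF e e] by simp
  have "\<forall>\<^sub>F n in sequentially. norm (dist (z n) ?p) \<le> e n + e n"
    unfolding real_norm_def abs_of_nonneg[OF zero_le_dist] using z(2) by (intro always_eventually allI)
  then have "(\<lambda>n. dist (z n) ?p) \<longlonglongrightarrow> 0"
    using lim by (rule Lim_null_comparison)
  then have "z \<longlonglongrightarrow> ?p" by (rule iffD2[OF tendsto_dist_iff])
  then show "?p \<in> L" by (rule closed_sequentially[OF \<open>closed L\<close> z(1)])
qed

text \<open>If \<open>x\<close> were outside \<open>K\<close>, a hyperplane would separate them, and
  the point of the ball farthest from it on the side of \<open>x\<close> would have distance more
  than \<open>e\<close> from \<open>K\<close>.\<close>

lemma cball_subset_hausdorff_close_convex: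
  fixes K L :: "'a::euclidean_space set"
  assumes K: "convex K" "closed K" and close: "hausdorff_close e K L"
    and "cball x r \<subseteq> L" "e < r" "0 \<le> r"
  shows "x \<in> K"
proof (rule ccontr)
  assume "x \<notin> K"
  obtain a b where ab: "a \<bullet> x < b" "\<And>y. y \<in> K \<Longrightarrow> a \<bullet> y > b"
    using separating_hyperplane_closed_point[OF K \<open>x \<notin> K\<close>] by blast
  show False
  proof (cases "K = {}")
    case True
    then have "L = {}" using close unfolding hausdorff_close_def by blast
    then have "r < 0" using assms(4) cball_eq_empty by blast
    then show False using assms(6) by simp
  next
    case False
    then obtain k where "k \<in> K" by blast
    then obtain l where "dist k l \<le> e"
      using close unfolding hausdorff_close_def by blast
    then have "0 \<le> e" using zero_le_dist order_trans by blast
    have "a \<noteq> 0" using ab False by force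
    let ?p = "x - (r / norm a) *\<^sub>R a"
    have "?p \<in> cball x r" using assms(6) \<open>a \<noteq> 0\<close> by (simp add: dist_norm)
    then have "?p \<in> L" using assms(4) by blast
    then obtain y where y: "y \<in> K" "dist y ?p \<le> e" using close unfolding hausdorff_close_def by blast
    have "a \<bullet> y = a \<bullet> ?p + a \<bullet> (y - ?p)" by (simp add: inner_diff_right)
    also have "\<dots> \<le> a \<bullet> ?p + norm a * norm (y - ?p)"
      using norm_cauchy_schwarz[of a "y - ?p"] by linarith
    also have "\<dots> \<le> a \<bullet> ?p + norm a * e"
      using y(2) by (intro add_left_mono mult_left_mono) (auto simp: dist_norm)
    also have "a \<bullet> ?p = a \<bullet> x - r * norm a"
      using \<open>a \<noteq> 0\<close> by (simp add: inner_diff_right dot_square_norm power2_eq_square)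
    also have "a \<bullet> x - r * norm a + norm a * e = a \<bullet> x - norm a * (r - e)" by (simp add: algebra_simps)
    also have "\<dots> \<le> a \<bullet> x" using assms(5) by simp
    finally show False using ab y(1) by fastforce
  qed
qed

text \<open>The indicators converge off the frontier of \<open>L\<close>: on the interior by the
  ball lemma above, outside by positive distance to \<open>L\<close>. The limit \<open>L\<close> is
  convex, so its frontier is null, and one large ball dominates all indicators.\<close>

lemma measure_hausdorff_tendsto:
  fixes L :: "'a::euclidean_space set"
  assumes K: "\<And>n. compact (K n)" "\<And>n. convex (K n)" and L: "compact L"
    and close: "\<And>n. hausdorff_close (e n) (K n) L" and e: "e \<longlonglongrightarrow> 0"
  shows "(\<lambda>n. measure lborel (K n)) \<longlonglongrightarrow> measure lborel L"
proof -
  obtain r where r: "\<And>n. \<bar>e n\<bar> \<le> r"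
    using convergent_imp_Bseq[OF convergentI[OF e]] by (auto simp: Bseq_def)
  obtain R where R: "\<And>x. x \<in> L \<Longrightarrow> norm x \<le> R"
    using compact_imp_bounded[OF L] by (auto simp: bounded_iff)
  have sub: "K n \<subseteq> cball 0 (R + r)" for n
  proof
    fix x assume "x \<in> K n"
    then obtain y where "y \<in> L" "dist x y \<le> e n" using close[of n] unfolding hausdorff_close_def by blast
    then show "x \<in> cball 0 (R + r)"
      using R[of y] r[of n] norm_triangle_ineq[of y "x - y"] by (simp add: dist_norm)
  qed
  have "convex L" using convex_hausdorff_limit[OF K(2) compact_imp_closed[OF L] close e] .
  then have null: "frontier L \<in> null_sets lborel"
    using negligible_convex_frontier[of L]
    by (auto simp: null_sets_completion_iff negligible_iff_null_sets)
  have "AE x in lborel. (\<lambda>n. indicat_real (K n) x) \<longlonglongrightarrow> indicat_real L x"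
    using AE_not_in[OF null]
  proof eventually_elim
    case (elim x)
    have "\<forall>\<^sub>F n in sequentially. indicat_real (K n) x = indicat_real L x"
    proof (cases "x \<in> interior L")
      case True
      then obtain \<rho> where "0 < \<rho>" "cball x \<rho> \<subseteq> L" by (auto simp: mem_interior_cball)
      then have "x \<in> K n" if "e n < \<rho>" for n
        using that cball_subset_hausdorff_close_convex[OF K(2) compact_imp_closed[OF K(1)] close]
        by fastforce
      then have "\<forall>\<^sub>F n in sequentially. x \<in> K n"
        using order_tendstoD(2)[OF e \<open>0 < \<rho>\<close>] by (rule eventually_mono[rotated])
      then show ?thesis
        using True interior_subset[of L] by (auto elim!: eventually_mono simp: indicator_def)
    next
      case False
      then have out: "x \<notin> L" using elim L by (simp add: frontier_def compact_imp_closed)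
      show ?thesis
      proof (cases "L = {}")
        case True
        then have "K n = {}" for n using close[of n] unfolding hausdorff_close_def by blast
        then show ?thesis using True by simp
      next
        case False
        have "0 < infdist x L"
          using out False L by (metis compact_imp_closed in_closed_iff_infdist_zero infdist_nonneg order_le_less)
        have "x \<notin> K n" if "e n < infdist x L" for n
        proof
          assume "x \<in> K n"
          then obtain y where "y \<in> L" "dist x y \<le> e n"
            using close[of n] unfolding hausdorff_close_def by blast
          then show False using infdist_le[of y L x] that by linarith
        qed
        then have "\<forall>\<^sub>F n in sequentially. x \<notin> K n"
          using order_tendstoD(2)[OF e \<open>0 < infdist x L\<close>] by (rule eventually_mono[rotated])
        then show ?thesis using out by (auto elim!: eventually_mono simp: indicator_def)
      qed
    qed
    then show ?case by (rule tendsto_eventually)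
  qed
  moreover have "norm (indicat_real (K n) x) \<le> indicat_real (cball 0 (R + r)) x" for n x
    using sub[of n] by (auto simp: indicator_def)
  moreover have "integrable lborel (indicat_real (cball 0 (R + r) :: 'a set))"
    by (intro integrable_real_indicator) (auto simp: emeasure_lborel_cball_finite[unfolded infinity_ennreal_def])
  ultimately have "(\<lambda>n. integral\<^sup>L lborel (indicat_real (K n))) \<longlonglongrightarrow> integral\<^sup>L lborel (indicat_real L)"
    using K(1) L
    by (intro integral_dominated_convergence[where w = "indicat_real (cball 0 (R + r))"])
      (simp_all add: borel_measurable_indicator borel_compact)
  then show ?thesis using K(1) L by (simp add: borel_compact)
qed

subsection \<open>The inequality in coordinates\<close>

definition drop_y :: "(real \<times> real) \<times> real \<Rightarrow> real \<times> real" where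
  "drop_y p = (fst (fst p), snd p)"

definition drop_x :: "(real \<times> real) \<times> real \<Rightarrow> real \<times> real" where
  "drop_x p = (snd (fst p), snd p)"

text \<open>The theorem in coordinates whose last axis is orthogonal to both \<open>u\<close> and
  \<open>v\<close>. The factor \<open>sqrt (1 - (u \<bullet> v)^2)\<close> is absorbed by the
  determinant of the change of coordinates.\<close>

definition local_loomis_whitney :: "((real \<times> real) \<times> real) set \<Rightarrow> bool" where
  "local_loomis_whitney B \<longleftrightarrow>
     measure lborel B * measure lborel (snd ` B) \<le> measure lborel (drop_y ` B) * measure lborel (drop_x ` B)"

lemma linear_drop: "linear drop_y" "linear drop_x" "linear (snd :: (real \<times> real) \<times> real \<Rightarrow> real)"
  by (auto intro!: linearI simp: drop_y_def drop_x_def)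

lemma norm_drop_le:
  "norm (drop_y p) \<le> 1 * norm p" "norm (drop_x p) \<le> 1 * norm p" "norm (snd p) \<le> 1 * norm p"
  for p :: "(real \<times> real) \<times> real"
  by (auto simp: drop_y_def drop_x_def norm_prod_def intro: real_le_rsqrt)

lemma local_loomis_whitney_zono_generic:
  fixes g :: "nat \<Rightarrow> (real \<times> real) \<times> real"
  assumes "\<And>i. snd (g i) \<noteq> 0"
  shows "local_loomis_whitney (zono g n)"
proof -
  define z x y where "z i = snd (g i)" and "x i = fst (fst (g i)) / snd (g i)"
    and "y i = snd (fst (g i)) / snd (g i)" for i
  have g: "g = (\<lambda>i. (z i *\<^sub>R (x i, y i), z i))"
    using assms by (auto simp: z_def x_def y_def prod_eq_iff)
  have pair: "2 * measure lborel (zono (\<lambda>i. (z i * x i, z i)) n) = pair_sum {..<n} (\<lambda>i. \<bar>z i\<bar>) x"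
    for x :: "nat \<Rightarrow> real"
    unfolding measure_zono_planar pair_sum_def
    by (intro sum.cong) (auto simp: det2_def algebra_simps simp flip: abs_mult)
  have V: "6 * measure lborel (zono g n) = triple_sum {..<n} (\<lambda>i. \<bar>z i\<bar>) x y"
    unfolding g by (rule measure_zono_3d)
  have H: "measure lborel (snd ` zono g n) = (\<Sum>i<n. \<bar>z i\<bar>)"
    by (simp add: linear_image_zono[OF linear_drop(3)] measure_zono_real z_def)
  have X: "2 * measure lborel (drop_y ` zono g n) = pair_sum {..<n} (\<lambda>i. \<bar>z i\<bar>) x"
    unfolding linear_image_zono[OF linear_drop(1)] pair[symmetric] by (simp add: g o_def drop_y_def)
  have Y: "2 * measure lborel (drop_x ` zono g n) = pair_sum {..<n} (\<lambda>i. \<bar>z i\<bar>) y"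
    unfolding linear_image_zono[OF linear_drop(2)] pair[symmetric] by (simp add: g o_def drop_x_def)
  \<comment> \<open>After inserting \<open>V\<close>, \<open>X\<close> and \<open>Y\<close> both
    sides of the weighted inequality carry the factor 12.\<close>
  show ?thesis
    using triple_sum_le_pair_sums[of "{..<n}" "\<lambda>i. \<bar>z i\<bar>" x y]
    unfolding V[symmetric] X[symmetric] Y[symmetric] H[symmetric] local_loomis_whitney_def
    by (simp add: mult_ac)
qed

text \<open>All four volumes are continuous along the sequence: the projections do not increase
  norms, so the images converge at the same rate \<open>e\<close>.\<close>

lemma local_loomis_whitney_limit:
  assumes K: "\<And>n. compact (K n)" "\<And>n. convex (K n)" and L: "compact L"
    and close: "\<And>n. hausdorff_close (e n) (K n) L" and e: "e \<longlonglongrightarrow> 0"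
    and loomis: "\<And>n. local_loomis_whitney (K n)"
  shows "local_loomis_whitney L"
proof -
  have lim: "(\<lambda>n. measure lborel (f ` K n)) \<longlonglongrightarrow> measure lborel (f ` L)"
    if f: "linear f" "\<And>p. norm (f p) \<le> 1 * norm p" for f :: "(real \<times> real) \<times> real \<Rightarrow> 'c::euclidean_space"
  proof (rule measure_hausdorff_tendsto[OF _ _ _ _ e])
    show "compact (f ` K n)" "compact (f ` L)" for n
      using K L by (simp_all add: compact_linear_image[OF f(1)])
    show "convex (f ` K n)" for n using f(1) K(2) by (rule convex_linear_image)
    show "hausdorff_close (e n) (f ` K n) (f ` L)" for n
      using hausdorff_close_linear_image[OF close f] by simp
  qed
  show ?thesis
    unfolding local_loomis_whitney_def
  proof (rule LIMSEQ_le)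
    show "(\<lambda>n. measure lborel (K n) * measure lborel (snd ` K n)) \<longlonglongrightarrow> measure lborel L * measure lborel (snd ` L)"
      by (intro tendsto_mult lim[OF linear_drop(3) norm_drop_le(3)] measure_hausdorff_tendsto[OF K L close e])
    show "(\<lambda>n. measure lborel (drop_y ` K n) * measure lborel (drop_x ` K n))
        \<longlonglongrightarrow> measure lborel (drop_y ` L) * measure lborel (drop_x ` L)"
      by (intro tendsto_mult lim linear_drop norm_drop_le)
  qed (use loomis in \<open>auto simp: local_loomis_whitney_def\<close>)
qed

text \<open>The same coefficients in [0, 1] are used for both families of generators.\<close>

lemma zono_near:
  fixes g h :: "nat \<Rightarrow> 'a::real_normed_vector"
  shows "\<forall>p\<in>zono g n. \<exists>q\<in>zono h n. dist p q \<le> (\<Sum>i<n. norm (g i - h i))"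
proof (induction n)
  case (Suc n)
  show ?case
  proof
    fix p assume "p \<in> zono g (Suc n)"
    then obtain a b where p: "p = a + b" "a \<in> zono g n" "b \<in> closed_segment 0 (g n)"
      by (auto simp: zono_Suc set_plus_def)
    then obtain s where s: "0 \<le> s" "s \<le> 1" "b = s *\<^sub>R g n" by (auto simp: in_segment)
    obtain c where c: "c \<in> zono h n" "dist a c \<le> (\<Sum>i<n. norm (g i - h i))" using Suc p(2) by blast
    have "s *\<^sub>R h n \<in> closed_segment 0 (h n)" using s by (auto simp: in_segment)
    then have "c + s *\<^sub>R h n \<in> zono h (Suc n)" using c by (simp add: zono_Suc set_plus_intro)
    moreover have "dist p (c + s *\<^sub>R h n) \<le> (\<Sum>i<Suc n. norm (g i - h i))"
    proof -
      have "dist p (c + s *\<^sub>R h n) \<le> dist a c + dist b (s *\<^sub>R h n)"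
        unfolding p(1) by (rule dist_triangle_add)
      moreover have "dist b (s *\<^sub>R h n) = s * norm (g n - h n)"
        using s by (simp add: dist_norm flip: scaleR_diff_right)
      moreover have "s * norm (g n - h n) \<le> norm (g n - h n)"
        using s by (simp add: mult_left_le_one_le)
      ultimately show ?thesis using c(2) by simp
    qed
    ultimately show "\<exists>q\<in>zono h (Suc n). dist p q \<le> (\<Sum>i<Suc n. norm (g i - h i))" by blast
  qed
qed simp

lemma hausdorff_close_zono:
  "hausdorff_close (\<Sum>i<n. norm (g i - h i)) (zono g n) (zono h n)"
  using zono_near[of g n h] zono_near[of h n g]
  by (simp add: hausdorff_close_def norm_minus_commute dist_commute)

lemma local_loomis_whitney_zono:
  fixes g :: "nat \<Rightarrow> (real \<times> real) \<times> real"
  shows "local_loomis_whitney (zono g n)"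
proof (rule local_loomis_whitney_limit)
  \<comment> \<open>Horizontal generators are lifted slightly to reach the generic case;
    \<open>Suc m\<close> keeps the height nonzero for \<open>m = 0\<close> as well.\<close>
  define h where "h m i = (fst (g i), if snd (g i) = 0 then inverse (real (Suc m)) else snd (g i))" for m i
  show "compact (zono (h m) n)" "convex (zono (h m) n)" "compact (zono g n)" for m
    by (rule compact_zono convex_zono)+
  show "local_loomis_whitney (zono (h m) n)" for m
    by (rule local_loomis_whitney_zono_generic) (simp add: h_def)
  show "hausdorff_close (\<Sum>i<n. norm (h m i - g i)) (zono (h m) n) (zono g n)" for m
    by (rule hausdorff_close_zono)
  have "(\<lambda>m. norm (h m i - g i)) \<longlonglongrightarrow> 0" for i
  proof (cases "snd (g i) = 0")
    case True
    then have "h m i - g i = (0, inverse (real (Suc m)))" for m by (simp add: h_def prod_eq_iff)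
    then show ?thesis using LIMSEQ_inverse_real_of_nat by (simp add: norm_Pair)
  next
    case False
    then show ?thesis by (simp add: h_def)
  qed
  then show "(\<lambda>m. \<Sum>i<n. norm (h m i - g i)) \<longlonglongrightarrow> 0"
    by (intro tendsto_null_sum)
qed

section \<open>From zonotopes to zonoids\<close>

lemma local_loomis_whitney_translation:
  assumes "compact B"
  shows "local_loomis_whitney ((\<lambda>x. x + c) ` B) \<longleftrightarrow> local_loomis_whitney B"
proof -
  have tr: "measure lborel (f ` (\<lambda>x. x + c) ` B) = measure lborel (f ` B)"
    if f: "linear f" for f :: "(real \<times> real) \<times> real \<Rightarrow> 'c::euclidean_space"
  proof -
    have "compact (f ` B)" by (rule compact_linear_image[OF f assms])
    moreover have "f ` (\<lambda>x. x + c) ` B = (\<lambda>x. x + f c) ` f ` B"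
      by (simp add: image_image linear_add[OF f])
    ultimately show ?thesis by (simp add: measure_lborel_translation)
  qed
  then show ?thesis
    by (simp add: local_loomis_whitney_def tr[OF linear_drop(1)] tr[OF linear_drop(2)]
      tr[OF linear_drop(3)] measure_lborel_translation[OF assms])
qed

lemma zonotope_eq_translate_zono:
  fixes Z :: "'a::euclidean_space set"
  assumes "zonotope Z"
  obtains c g n where "Z = (\<lambda>x. x + c) ` zono g n"
proof -
  obtain n a b where Z: "Z = (\<Sum>i<(n::nat). closed_segment (a i) (b i))"
    using assms by (auto simp: zonotope_def)
  have "(\<Sum>i<n. closed_segment (a i) (b i)) = (\<lambda>x. x + (\<Sum>i<n. a i)) ` zono (\<lambda>i. b i - a i) n"
  proof (induction n)
    case (Suc n)
    have "closed_segment (a n) (b n) = (\<lambda>x. x + a n) ` closed_segment 0 (b n - a n)"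
      using closed_segment_translation[of "a n" 0 "b n - a n"] by (simp add: add.commute)
    moreover have "(\<lambda>x. x + p) ` A + (\<lambda>x. x + q) ` B = (\<lambda>x. x + (p + q)) ` (A + B)" for p q :: 'a and A B
      unfolding set_plus_image by (force simp: image_iff algebra_simps)
    ultimately show ?case by (simp add: Suc zono_Suc)
  qed simp
  then show thesis using that Z by blast
qed

text \<open>A linear map sends zonotopes to zonotopes and enlarges Hausdorff distances at most by a
  constant factor. Arbitrary linear \<open>f\<close> is allowed so that the oblique coordinates of
  the final proof can be inserted.\<close>

lemma local_loomis_whitney_zonoid:
  fixes f :: "'a::euclidean_space \<Rightarrow> (real \<times> real) \<times> real"
  assumes "zonoid A" and f: "linear f"
  shows "local_loomis_whitney (f ` A)"
proof -
  obtain Z where A: "compact A" "A \<noteq> {}" and Z: "\<And>n. zonotope (Z n)"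
      and lim: "(\<lambda>n. hausdorff_dist (Z n) A) \<longlonglongrightarrow> 0"
    using assms(1) by (auto simp: zonoid_def)
  obtain C where C: "0 < C" "\<And>x. norm (f x) \<le> C * norm x"
    using linear_bounded_pos[OF f] by (metis mult.commute)
  have zono: "compact (Z n) \<and> Z n \<noteq> {} \<and> convex (Z n) \<and> local_loomis_whitney (f ` Z n)" for n
  proof -
    obtain c g m where Zn: "Z n = (\<lambda>x. x + c) ` zono g m"
      using zonotope_eq_translate_zono[OF Z] .
    have "convex (Z n)"
      using convex_translation[OF convex_zono, of c g m] by (simp add: Zn add.commute)
    moreover have "compact (Z n)"
      using compact_translation[OF compact_zono, of c g m] by (simp add: Zn add.commute)
    moreover have "Z n \<noteq> {}" by (simp add: Zn zono_nonempty)
    moreover have "f ` Z n = (\<lambda>x. x + f c) ` zono (f \<circ> g) m"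
      by (simp add: Zn image_image linear_add[OF f] flip: linear_image_zono[OF f])
    then have "local_loomis_whitney (f ` Z n)"
      by (simp add: local_loomis_whitney_translation compact_zono local_loomis_whitney_zono)
    ultimately show ?thesis by blast
  qed
  show ?thesis
  proof (rule local_loomis_whitney_limit)
    show "compact (f ` Z n)" "compact (f ` A)" for n
      using zono A(1) by (simp_all add: compact_linear_image[OF f])
    show "convex (f ` Z n)" for n using zono by (simp add: convex_linear_image[OF f])
    show "local_loomis_whitney (f ` Z n)" for n using zono by blast
    show "hausdorff_close (C * hausdorff_dist (Z n) A) (f ` Z n) (f ` A)" for n
      using hausdorff_close_hausdorff_dist[of "Z n" A] zono[of n] A C
      by (intro hausdorff_close_linear_image f) auto
    show "(\<lambda>n. C * hausdorff_dist (Z n) A) \<longlonglongrightarrow> 0"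
      using tendsto_mult_left[OF lim, of C] by simp
  qed
qed

subsection \<open>Volumes of orthogonal projections\<close>

lemma orth_proj_eqI:
  fixes E :: "'a::euclidean_space set"
  assumes "subspace E" "y \<in> E" "x - y \<in> orthogonal_comp E"
  shows "orth_proj E x = y"
proof -
  let ?p = "orth_proj E x"
  have p: "?p \<in> E" "x - ?p \<in> orthogonal_comp E" using orth_proj[OF assms(1)] by auto
  have "?p - y \<in> E" using p assms by (simp add: subspace_diff)
  then have "(?p - y) \<bullet> (x - y) = 0" "(?p - y) \<bullet> (x - ?p) = 0"
    using p(2) assms(3) by (auto simp: orthogonal_comp_def orthogonal_def)
  then have "(?p - y) \<bullet> (?p - y) = 0" by (simp add: inner_diff_right)
  then show ?thesis by simp
qed

text \<open>Since \<open>f\<close> preserves inner products, the residual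
  \<open>x - f (adjoint f x)\<close> is orthogonal to its range.\<close>

lemma orth_proj_isometric_param:
  fixes f :: "real^'m \<Rightarrow> 'a::euclidean_space"
  assumes f: "isometric_param f E"
  shows "orth_proj E x = f (adjoint f x)"
proof (rule orth_proj_eqI)
  have lin: "linear f" and norm: "\<And>c. norm (f c) = norm c" and E: "E = range f"
    using f by (auto simp: isometric_param_def)
  show "subspace E" unfolding E using lin by (simp add: linear_subspace_image)
  show "f (adjoint f x) \<in> E" by (simp add: E)
  have inner: "f c \<bullet> f d = c \<bullet> d" for c d
    using norm[of "c + d"] norm[of c] norm[of d]
    by (simp add: dot_norm linear_add[OF lin, symmetric])
  have "f c \<bullet> (x - f (adjoint f x)) = 0" for c
    by (simp add: inner_diff_right inner adjoint_works[OF lin])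
  then show "x - f (adjoint f x) \<in> orthogonal_comp E"
    by (auto simp: E orthogonal_comp_def orthogonal_def)
qed

text \<open>By \<open>subspace_volume_eq\<close> any convenient isometry may replace the chosen one,
  and in its coordinates the projection is the adjoint.\<close>

lemma subspace_volume_orth_proj:
  fixes f :: "real^'m::{finite,wellorder} \<Rightarrow> 'a::euclidean_space"
  assumes f: "isometric_param f E" and "compact A"
  shows "subspace_volume TYPE('m) E (orth_proj E ` A) = measure lborel (adjoint f ` A)"
proof -
  have lin: "linear f" and norm: "\<And>c. norm (f c) = norm c" and E: "E = range f"
    using f by (auto simp: isometric_param_def)
  have "inj f" using norm linear_injective_0[OF lin] by (metis norm_eq_zero)
  moreover have "orth_proj E ` A = f ` adjoint f ` A"
    by (simp add: orth_proj_isometric_param[OF f] image_image)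
  ultimately have vim: "f -` (orth_proj E ` A) = adjoint f ` A"
    by (simp add: inj_vimage_image_eq)
  have c: "compact (adjoint f ` A)"
    by (rule compact_linear_image[OF adjoint_linear[OF lin] assms(2)])
  have "subspace_volume TYPE('m) E (orth_proj E ` A) = measure lebesgue (f -` (orth_proj E ` A))"
  proof (rule subspace_volume_eq[OF f])
    show "orth_proj E ` A \<subseteq> E" using orth_proj_isometric_param[OF f] E by auto
    show "f -` (orth_proj E ` A) \<in> lmeasurable" unfolding vim by (rule lmeasurable_compact[OF c])
  qed
  then show ?thesis using c by (simp add: vim borel_compact)
qed

text \<open>Used to show that frames span. Lagrange's identity makes the cross product of
  \<open>d\<close> with \<open>cross3 a b\<close> vanish, so \<open>d\<close> would be both parallel
  and orthogonal to a nonzero vector.\<close>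

lemma cross3_orthogonal_eq_0:
  fixes d :: "real^3"
  assumes "d \<bullet> a = 0" "d \<bullet> b = 0" "d \<bullet> cross3 a b = 0" "cross3 a b \<noteq> 0"
  shows "d = 0"
proof (rule ccontr)
  assume "d \<noteq> 0"
  have "cross3 d (cross3 a b) = cross3 d 0" by (simp add: Lagrange assms(1,2))
  then show False using cross_dot_cancel[of d "cross3 a b" 0] \<open>d \<noteq> 0\<close> assms(3,4) by simp
qed

lemma norm_cross3_orthonormal:
  fixes a b :: "real^3"
  assumes "norm a = 1" "norm b = 1" "a \<bullet> b = 0"
  shows "norm (cross3 a b) = 1"
proof -
  have "(norm (cross3 a b))\<^sup>2 = 1" using assms by (simp add: norm_cross)
  then show ?thesis by (metis norm_ge_zero power2_eq_1_iff neg_0_le_iff_le not_one_le_zero)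
qed

text \<open>The vectors \<open>cross3 w u\<close> and \<open>w\<close> form an orthonormal frame of
  the plane. Keeping \<open>w\<close> as second vector lets the planes of \<open>u\<close> and
  \<open>v\<close> share a coordinate.\<close>

lemma subspace_volume_2:
  fixes u w :: "real^3"
  assumes u: "norm u = 1" and w: "norm w = 1" and uw: "u \<bullet> w = 0" and A: "compact A"
  shows "subspace_volume TYPE(2) (orthogonal_comp {u}) (orth_proj (orthogonal_comp {u}) ` A)
    = measure lborel ((\<lambda>a. (a \<bullet> cross3 w u, a \<bullet> w)) ` A)"
proof -
  define r where "r = cross3 w u"
  define f :: "real^2 \<Rightarrow> real^3" where "f c = (c $ 1) *\<^sub>R r + (c $ 2) *\<^sub>R w" for c
  have r: "norm r = 1" "r \<bullet> w = 0" "r \<bullet> u = 0"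
    using norm_cross3_orthonormal[OF w u] uw by (simp_all add: r_def inner_commute dot_cross_self)
  have rw: "r \<bullet> r = 1" "w \<bullet> w = 1" "r \<bullet> w = 0" "w \<bullet> r = 0" "r \<bullet> u = 0" "w \<bullet> u = 0"
    using r w uw by (simp_all add: dot_square_norm inner_commute)
  have lin: "linear f" by (rule linearI) (auto simp: f_def algebra_simps)
  have f: "isometric_param f (orthogonal_comp {u})"
    unfolding isometric_param_def
  proof (intro conjI allI equalityI subsetI)
    fix c
    have "f c \<bullet> f c = c $ 1 * c $ 1 + c $ 2 * c $ 2"
      by (simp add: f_def inner_add_left inner_add_right rw)
    also have "\<dots> = c \<bullet> c" unfolding inner_vec_def sum_2 by simp
    finally show "norm (f c) = norm c" by (simp add: norm_eq)
  next
    fix x assume "x \<in> range f"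
    then show "x \<in> orthogonal_comp {u}"
      using rw by (auto simp: f_def orthogonal_comp_def orthogonal_def inner_add_left inner_commute[of u] inner_add_right)
  next
    fix x assume x: "x \<in> orthogonal_comp {u}"
    define c :: "real^2" where "c = vector [x \<bullet> r, x \<bullet> w]"
    have "x - f c = 0"
    proof (rule cross3_orthogonal_eq_0[of _ w u])
      show "(x - f c) \<bullet> w = 0" "(x - f c) \<bullet> cross3 w u = 0"
        unfolding r_def[symmetric] by (simp_all add: f_def c_def inner_diff_left inner_add_left rw)
      have "x \<bullet> u = 0" using x by (simp add: orthogonal_comp_def orthogonal_def inner_commute)
      then show "(x - f c) \<bullet> u = 0" by (simp add: f_def inner_diff_left inner_add_left rw)
      show "cross3 w u \<noteq> 0" using r by (auto simp flip: r_def)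
    qed
    then show "x \<in> range f" by (metis eq_iff_diff_eq_0 rangeI)
  qed (rule lin)
  have adj: "adjoint f = (\<lambda>a. vector [a \<bullet> r, a \<bullet> w])"
  proof (rule adjoint_unique, intro allI)
    fix x y
    have "x \<bullet> vector [y \<bullet> r, y \<bullet> w] = x $ 1 * (y \<bullet> r) + x $ 2 * (y \<bullet> w)" for x :: "real^2"
      by (simp only: inner_vec_def[of x] sum_2 vector_2 inner_real_def)
    then show "f x \<bullet> y = x \<bullet> vector [y \<bullet> r, y \<bullet> w]"
      by (simp add: f_def inner_add_left inner_commute[of y])
  qed
  define T :: "real^2 \<Rightarrow> real \<times> real" where "T x = (x $ 1, x $ 2)" for x
  have T: "linear T" by (rule linearI) (auto simp: T_def)
  have bij: "bij_betw T Basis Basis"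
  proof -
    have "T ` Basis = Basis"
      by (auto simp: T_def Basis_vec_def Basis_prod_def UNIV_2 axis_def)
    moreover have "inj T" by (auto simp: inj_def T_def vec_eq_iff forall_2)
    ultimately show ?thesis by (auto simp: bij_betw_def intro: inj_on_subset)
  qed
  have c: "compact (adjoint f ` A)"
    by (rule compact_linear_image[OF adjoint_linear[OF lin] A])
  have "measure lborel (adjoint f ` A) = measure lborel (T ` adjoint f ` A)"
    using measure_lborel_basis_map[OF T bij c] by simp
  also have "T ` adjoint f ` A = (\<lambda>a. (a \<bullet> cross3 w u, a \<bullet> w)) ` A"
    by (simp add: adj image_image T_def r_def)
  finally show ?thesis using subspace_volume_orth_proj[OF f A] by simp
qed

text \<open>The nonzero cross product says that \<open>u\<close> and \<open>v\<close> are
  independent, so the complement of their span is exactly the line through \<open>w\<close>.\<close>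

lemma subspace_volume_1:
  fixes u v w :: "real^3"
  assumes w: "norm w = 1" "u \<bullet> w = 0" "v \<bullet> w = 0" and d: "cross3 u v = d *\<^sub>R w" "d \<noteq> 0"
    and A: "compact A"
  shows "subspace_volume TYPE(1) (orthogonal_comp (span {u, v})) (orth_proj (orthogonal_comp (span {u, v})) ` A)
    = measure lborel ((\<lambda>a. a \<bullet> w) ` A)"
proof -
  define f :: "real^1 \<Rightarrow> real^3" where "f c = (c $ 1) *\<^sub>R w" for c
  have lin: "linear f" by (rule linearI) (auto simp: f_def algebra_simps)
  have f: "isometric_param f (orthogonal_comp (span {u, v}))"
    unfolding isometric_param_def
  proof (intro conjI allI equalityI subsetI)
    fix c show "norm (f c) = norm c" using w by (simp add: f_def norm_real)
  next
    fix x assume "x \<in> range f"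
    then obtain c where x: "x = c *\<^sub>R w" by (auto simp: f_def)
    have "orthogonal x y" if "y \<in> span {u, v}" for y
      using that
    proof (rule orthogonal_to_span)
      show "orthogonal x y" if "y \<in> {u, v}" for y
        using that w by (auto simp: orthogonal_def x inner_commute)
    qed
    then show "x \<in> orthogonal_comp (span {u, v})" by (simp add: orthogonal_comp_def orthogonal_commute)
  next
    fix x assume "x \<in> orthogonal_comp (span {u, v})"
    then have x: "x \<bullet> u = 0" "x \<bullet> v = 0"
      by (simp_all add: orthogonal_comp_def orthogonal_def span_base inner_commute)
    define c :: "real^1" where "c = vec (x \<bullet> w)"
    have "x - f c = 0"
    proof (rule cross3_orthogonal_eq_0[of _ u v])
      show "(x - f c) \<bullet> u = 0" "(x - f c) \<bullet> v = 0" "(x - f c) \<bullet> cross3 u v = 0"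
        using x w by (simp_all add: f_def c_def d inner_diff_left inner_commute[of w] dot_square_norm)
      show "cross3 u v \<noteq> 0" using w d by auto
    qed
    then show "x \<in> range f" by (metis eq_iff_diff_eq_0 rangeI)
  qed (rule lin)
  have adj: "adjoint f = (\<lambda>a. vec (a \<bullet> w))"
  proof (rule adjoint_unique, intro allI)
    fix x y
    have "x \<bullet> vec (y \<bullet> w) = x $ 1 * (y \<bullet> w)" for x :: "real^1"
      by (simp only: inner_vec_def[of x] sum_1 vec_component inner_real_def)
    then show "f x \<bullet> y = x \<bullet> vec (y \<bullet> w)" by (simp add: f_def inner_commute[of y])
  qed
  define T :: "real^1 \<Rightarrow> real" where "T x = x $ 1" for x
  have T: "linear T" by (rule linearI) (auto simp: T_def)
  have bij: "bij_betw T Basis Basis"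
  proof -
    have "T ` Basis = Basis"
      by (auto simp: T_def Basis_vec_def UNIV_1 axis_def)
    moreover have "inj T" by (auto simp: inj_def T_def vec_eq_iff forall_1)
    ultimately show ?thesis by (auto simp: bij_betw_def intro: inj_on_subset)
  qed
  have c: "compact (adjoint f ` A)"
    by (rule compact_linear_image[OF adjoint_linear[OF lin] A])
  have "measure lborel (adjoint f ` A) = measure lborel (T ` adjoint f ` A)"
    using measure_lborel_basis_map[OF T bij c] by simp
  also have "T ` adjoint f ` A = (\<lambda>a. a \<bullet> w) ` A"
    by (simp add: adj image_image T_def)
  finally show ?thesis using subspace_volume_orth_proj[OF f A] by simp
qed

text \<open>The map is the matrix with rows \<open>p\<close>, \<open>q\<close>, \<open>r\<close>
  followed by a regrouping of coordinates; its determinant is the triple product.\<close>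

lemma measure_frame_image:
  fixes p q r :: "real^3"
  assumes A: "compact A"
  shows "measure lborel ((\<lambda>a. ((a \<bullet> p, a \<bullet> q), a \<bullet> r)) ` A) = \<bar>p \<bullet> cross3 q r\<bar> * measure lborel A"
proof -
  define B :: "real^3^3" where "B = vector [p, q, r]"
  define T :: "real^3 \<Rightarrow> (real \<times> real) \<times> real" where "T x = ((x $ 1, x $ 2), x $ 3)" for x
  have T: "linear T" by (rule linearI) (auto simp: T_def)
  have bij: "bij_betw T Basis Basis"
  proof -
    have B1: "(Basis :: (real^3) set) = {axis 1 1, axis 2 1, axis 3 1}"
      by (auto simp: Basis_vec_def UNIV_3)
    have B2: "(Basis :: ((real \<times> real) \<times> real) set) = {((1, 0), 0), ((0, 1), 0), (0, 1)}"
      by (auto simp: Basis_prod_def)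
    have "T ` Basis = Basis"
      unfolding B1 B2 by (simp add: T_def axis_def zero_prod_def)
    moreover have "inj T" by (auto simp: inj_def T_def vec_eq_iff forall_3)
    ultimately show ?thesis by (auto simp: bij_betw_def intro: inj_on_subset)
  qed
  have c: "compact ((*v) B ` A)"
    using A by (simp add: compact_linear_image)
  have "(\<lambda>a. ((a \<bullet> p, a \<bullet> q), a \<bullet> r)) ` A = T ` (*v) B ` A"
    by (simp add: image_image T_def B_def matrix_vector_mul_component inner_commute)
  then have "measure lborel ((\<lambda>a. ((a \<bullet> p, a \<bullet> q), a \<bullet> r)) ` A) = measure lborel ((*v) B ` A)"
    using measure_lborel_basis_map[OF T bij c] by simp
  also have "\<dots> = measure lebesgue ((*v) B ` A)" using c by (simp add: borel_compact)
  also have "\<dots> = \<bar>det B\<bar> * measure lebesgue A"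
    using measure_linear_image[of "(*v) B" A] A by (simp add: lmeasurable_compact)
  finally show ?thesis using A by (simp add: B_def dot_cross_det borel_compact)
qed

theorem theorem5p1:
  fixes A :: "(real^3) set" and u v :: "real^3"
  assumes "zonoid A" and "u \<in> sphere 0 1" and "v \<in> sphere 0 1"
  shows "measure lebesgue A
       * subspace_volume TYPE(1) (orthogonal_comp (span {u, v}))
           (orth_proj (orthogonal_comp (span {u, v})) ` A)
       * sqrt (1 - (u \<bullet> v)^2)
     \<le> subspace_volume TYPE(2) (orthogonal_comp {u}) (orth_proj (orthogonal_comp {u}) ` A)
       * subspace_volume TYPE(2) (orthogonal_comp {v}) (orth_proj (orthogonal_comp {v}) ` A)"
proof (cases "cross3 u v = 0")
  case True
  \<comment> \<open>Here \<open>u\<close> and \<open>v\<close> are parallel and the complement of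
    their span is a plane, whose \<open>TYPE(1)\<close> volume is unspecified. The vanishing root
    removes it, and the right-hand side is a product of measures.\<close>
  have "1 - (u \<bullet> v)^2 = 0"
    using norm_cross[of u v] True assms(2,3) by simp
  then show ?thesis by (simp add: subspace_volume_def)
next
  case False
  have u: "norm u = 1" and v: "norm v = 1" using assms(2,3) by simp_all
  have A: "compact A" using assms(1) by (simp add: zonoid_def)
  define d where "d = norm (cross3 u v)"
  define w where "w = (1 / d) *\<^sub>R cross3 u v"
  have d: "d > 0" "cross3 u v = d *\<^sub>R w" using False by (simp_all add: d_def w_def)
  have w: "norm w = 1" "u \<bullet> w = 0" "v \<bullet> w = 0"
    using False by (simp_all add: w_def d_def dot_cross_self)
  have sqrt: "sqrt (1 - (u \<bullet> v)^2) = d"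
    using norm_cross[of u v] u v d(1) by (simp add: d_def real_sqrt_unique)
  \<comment> \<open>Quarter turns of \<open>u\<close> and \<open>v\<close> in their plane, so that
    \<open>p\<close>, \<open>w\<close> and \<open>q\<close>, \<open>w\<close> are orthonormal frames
    of the planes orthogonal to \<open>u\<close> and \<open>v\<close>.\<close>
  define p q where "p = cross3 w u" and "q = cross3 w v"
  define f where "f a = ((a \<bullet> p, a \<bullet> q), a \<bullet> w)" for a
  have "linear f" by (rule linearI) (auto simp: f_def inner_add_left)
  then have "local_loomis_whitney (f ` A)" by (rule local_loomis_whitney_zonoid[OF assms(1)])
  then have "measure lborel (f ` A) * measure lborel ((\<lambda>a. a \<bullet> w) ` A)
      \<le> measure lborel ((\<lambda>a. (a \<bullet> p, a \<bullet> w)) ` A) * measure lborel ((\<lambda>a. (a \<bullet> q, a \<bullet> w)) ` A)"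
    by (simp add: local_loomis_whitney_def image_image f_def drop_y_def drop_x_def)
  moreover have "measure lborel (f ` A) = d * measure lebesgue A"
  proof -
    \<comment> \<open>The Jacobian of \<open>f\<close> is \<open>p \<bullet> cross3 q w\<close>,
      hence \<open>cross3 w u \<bullet> v\<close>, hence \<open>w \<bullet> cross3 u v\<close>,
      which is \<open>d\<close>.\<close>
    have "cross3 q w = v"
      using w cross_skew[of q w] Lagrange[of w w v] by (simp add: q_def dot_square_norm inner_commute)
    then have "p \<bullet> cross3 q w = d"
      using w d(2) cross_triple[of w u v] by (simp add: p_def dot_square_norm)
    then show ?thesis
      using measure_frame_image[OF A, of p q w] A d(1) by (simp add: f_def borel_compact)
  qed
  ultimately show ?thesis
    unfolding sqrt subspace_volume_1[OF w d(2) less_imp_neq[OF d(1), symmetric] A]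
      subspace_volume_2[OF u w(1,2) A] subspace_volume_2[OF v w(1,3) A] p_def q_def
    by (simp add: mult_ac)
qed

end
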